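(* For every $k\in\mathbb{N}$, none of the following functionals is computable (in Kleene's S1–S9 sense) in $\mathsf{S}_k^{2}$: (a) any functional $\Phi:(\mathbb{R}\to\mathbb{R})\to\mathbb{R}$ such that for all cliquish $f:[0,1]\to[0,1]$ we have $\Phi(f)\in C_f$; (b) any functional $\Psi:(\mathbb{R}\to\mathbb{R})\to(\mathbb{R}^2\to\mathbb{R})$ such that for all cliquish $f:[0,1]\to[0,1]$ we have $\Psi(f,p,q)=\sup_{x\in[p,q]}f(x)$ for $p,q\in[0,1]$; (c) any functional $\zeta:(\mathbb{R}\to\mathbb{R})\to((\mathbb{N}\times\mathbb{N})\to\mathbb{Q}^2)$ such that for all cliquish $f:[0,1]\to[0,1]$ and all $n,m\in\mathbb{N}$, $\zeta(f,m,n)$ is (the code of) an open interval with rational endpoints and $C_f=\bigcap_{n\in\mathbb{N}}\bigcup_{m\in\mathbb{N}}\zeta(f,m,n)$. Moreover, each of these functionals, together with $\exists^{2}$, computes a Cantor realiser.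
   Context: Computability is Kleene's higher-order computability given by S1–S9. $\exists^{2}$ is the functional $\varphi:\mathbb{N}^{\mathbb{N}}\to\{0,1\}$ with $\varphi(f)=0\leftrightarrow(\exists n)(f(n)=0)$. $\mathsf{S}_k^{2}$ is the type-2 functional deciding the truth of $\Sigma^1_k$-formulas (with parameters over $\mathbb{N}$ and $\mathbb{N}^{\mathbb{N}}$ only); $\mathsf{S}^2=\mathsf{S}^2_1$ is the Suslin functional: $\mathsf{S}(f)=0\leftrightarrow(\exists g\in\mathbb{N}^{\mathbb{N}})(\forall n)(f(\overline{g}n)=0)$. Subsets $A\subset\mathbb{R}$ are given by characteristic functions $F_A:\mathbb{R}\to\{0,1\}$. A function $f:[0,1]\to\mathbb{R}$ is cliquish at $x_0$ if for every $\varepsilon>0$ and every open neighbourhood $U$ of $x_0$ there is a non-empty open $G\subset U$ with $|f(x)-f(y)|<\varepsilon$ for all $x,y\in G$; $f$ is cliquish if it is cliquish at every point. $C_f$ is the set of points where $f$ is continuous. A Cantor realiser is any $\Phi:((\mathbb{R}\to\{0,1\})\times(\mathbb{R}\to\mathbb{N}))\to\mathbb{R}$ such that $\Phi(A,Y)\notin A$ whenever $A\subset[0,1]$ is non-empty and $Y:[0,1]\to\mathbb{N}$ is injective on $A$. *)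

theory Defs
  imports "HOL-Analysis.Analysis" "HOL-Library.Nat_Bijection" "HOL-Library.Countable"
begin

section \<open>Kleene computability S1 to S9\<close>

text \<open>
  Arguments of Kleene computations.  Every constructor is one finite type of the full
  set-theoretic type structure over \<open>\<nat>\<close>; writing 0 for \<open>\<nat>\<close>, 1 for \<open>0 \<rightarrow> 0\<close>, these are
  0, 1, \<open>1 \<rightarrow> 0\<close>, \<open>1 \<rightarrow> 1\<close> (the type of codes of functions \<open>\<real> \<rightarrow> \<real>\<close>), and the types
  \<open>(1 \<rightarrow> 1) \<rightarrow> 1\<close>, \<open>(1 \<rightarrow> 1) \<rightarrow> (1 \<rightarrow> 1 \<rightarrow> 1)\<close>, \<open>(1 \<rightarrow> 1) \<rightarrow> (0 \<rightarrow> 0 \<rightarrow> 0)\<close>.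
  The only scheme that introduces arguments of a new function type is S8, and the types it
  introduces are argument types of the functional that is applied.  The list is closed under this,
  so for arguments from the list no further types can occur in a computation.
\<close>

datatype obj =
    Num nat
  | Seq "nat \<Rightarrow> nat"
  | Fun2 "(nat \<Rightarrow> nat) \<Rightarrow> nat"
  | RFun "(nat \<Rightarrow> nat) \<Rightarrow> nat \<Rightarrow> nat"
  | OpR "((nat \<Rightarrow> nat) \<Rightarrow> nat \<Rightarrow> nat) \<Rightarrow> nat \<Rightarrow> nat"
  | OpRR "((nat \<Rightarrow> nat) \<Rightarrow> nat \<Rightarrow> nat) \<Rightarrow> (nat \<Rightarrow> nat) \<Rightarrow> (nat \<Rightarrow> nat) \<Rightarrow> nat \<Rightarrow> nat"
  | OpNN "((nat \<Rightarrow> nat) \<Rightarrow> nat \<Rightarrow> nat) \<Rightarrow> nat \<Rightarrow> nat \<Rightarrow> nat"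

text \<open>
  \<open>kleene e as r\<close> means that \<open>{e}(as)\<close> is defined with value \<open>r\<close>.  Indices are natural numbers,
  namely codes of finite sequences.  In S8 a functional of type
  \<open>\<sigma>\<^sub>1 \<rightarrow> \<dots> \<rightarrow> \<sigma>\<^sub>m \<rightarrow> 0\<close> with \<open>\<sigma>\<^sub>i = \<tau>\<^sub>1 \<rightarrow> \<dots> \<rightarrow> \<tau>\<^sub>l \<rightarrow> 0\<close> is applied to the objects
  \<open>\<lambda>y\<^sub>1 \<dots> y\<^sub>l. {d\<^sub>i}(y\<^sub>1, \<dots>, y\<^sub>l, as)\<close>, all of which must be total; for \<open>\<sigma>\<^sub>i = 0\<close> this is the number
  \<open>{d\<^sub>i}(as)\<close>.  For \<open>m = 1\<close> and pure types this is Kleene's S8.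
\<close>

inductive kleene :: "nat \<Rightarrow> obj list \<Rightarrow> nat \<Rightarrow> bool" where
  S1: "kleene (list_encode [1]) (Num a # as) (Suc a)"
| S2: "kleene (list_encode [2, q]) as q"
| S3: "kleene (list_encode [3]) (Num a # as) a"
| S4: "\<lbrakk>kleene d as s; kleene c (Num s # as) r\<rbrakk> \<Longrightarrow> kleene (list_encode [4, c, d]) as r"
| S5_0: "kleene c as r \<Longrightarrow> kleene (list_encode [5, c, d]) (Num 0 # as) r"
| S5_Suc: "\<lbrakk>kleene (list_encode [5, c, d]) (Num a # as) s; kleene d (Num a # Num s # as) r\<rbrakk>
    \<Longrightarrow> kleene (list_encode [5, c, d]) (Num (Suc a) # as) r"
| S6: "\<lbrakk>distinct p; set p = {..<length as}; kleene d (map (\<lambda>i. as ! i) p) r\<rbrakk>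
    \<Longrightarrow> kleene (list_encode [6, d, list_encode p]) as r"
| S7: "kleene (list_encode [7]) (Num a # Seq f # as) (f a)"
| S8_Fun2: "\<lbrakk>\<And>x. kleene d (Num x # Fun2 F # as) (g x)\<rbrakk>
    \<Longrightarrow> kleene (list_encode [8, d]) (Fun2 F # as) (F g)"
| S8_RFun: "\<lbrakk>\<And>x. kleene d (Num x # RFun F # as) (g x); kleene c (RFun F # as) n\<rbrakk>
    \<Longrightarrow> kleene (list_encode [8, d, c]) (RFun F # as) (F g n)"
| S8_OpR: "\<lbrakk>\<And>h x. kleene d (Seq h # Num x # OpR F # as) (G h x); kleene c (OpR F # as) n\<rbrakk>
    \<Longrightarrow> kleene (list_encode [8, d, c]) (OpR F # as) (F G n)"
| S8_OpRR: "\<lbrakk>\<And>h x. kleene d (Seq h # Num x # OpRR F # as) (G h x);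
      \<And>x. kleene a (Num x # OpRR F # as) (u x); \<And>x. kleene b (Num x # OpRR F # as) (v x);
      kleene c (OpRR F # as) n\<rbrakk>
    \<Longrightarrow> kleene (list_encode [8, d, a, b, c]) (OpRR F # as) (F G u v n)"
| S8_OpNN: "\<lbrakk>\<And>h x. kleene d (Seq h # Num x # OpNN F # as) (G h x);
      kleene b (OpNN F # as) m; kleene c (OpNN F # as) n\<rbrakk>
    \<Longrightarrow> kleene (list_encode [8, d, b, c]) (OpNN F # as) (F G m n)"
| S9: "\<lbrakk>m \<le> length as; kleene e (take m as) r\<rbrakk>
    \<Longrightarrow> kleene (list_encode [9, m]) (Num e # as) r"

context
  notes list_encode.simps [simp del] and list_encode_eq [simp]
begin

lemma kleene_1_iff: "kleene (list_encode [1]) as r \<longleftrightarrow>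
    (\<exists>a bs. as = Num a # bs \<and> r = Suc a)"
  by (subst kleene.simps) auto

lemma kleene_2_iff: "kleene (list_encode [2, q]) as r \<longleftrightarrow> r = q"
  by (subst kleene.simps) auto

lemma kleene_3_iff: "kleene (list_encode [3]) as r \<longleftrightarrow>
    (\<exists>a bs. as = Num a # bs \<and> r = a)"
  by (subst kleene.simps) auto

lemma kleene_4_iff: "kleene (list_encode [4, c, d]) as r \<longleftrightarrow>
    (\<exists>s. kleene d as s \<and> kleene c (Num s # as) r)"
  by (subst kleene.simps) auto

lemma kleene_5_0_iff: "kleene (list_encode [5, c, d]) (Num 0 # as) r \<longleftrightarrow> kleene c as r"
  by (subst kleene.simps) auto

lemma kleene_5_Suc_iff: "kleene (list_encode [5, c, d]) (Num (Suc a) # as) r \<longleftrightarrow>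
    (\<exists>s. kleene (list_encode [5, c, d]) (Num a # as) s \<and> kleene d (Num a # Num s # as) r)"
  by (subst kleene.simps) auto

lemma kleene_6_iff: "kleene (list_encode [6, d, list_encode p]) as r \<longleftrightarrow>
    (distinct p \<and> set p = {..<length as} \<and> kleene d (map (\<lambda>i. as ! i) p) r)"
  by (subst kleene.simps) auto

lemma kleene_7_iff: "kleene (list_encode [7]) as r \<longleftrightarrow>
    (\<exists>a f bs. as = Num a # Seq f # bs \<and> r = f a)"
  by (subst kleene.simps) auto

lemma kleene_8_Fun2_iff: "kleene (list_encode [8, d]) (Fun2 F # as) r \<longleftrightarrow>
    (\<exists>g. (\<forall>x. kleene d (Num x # Fun2 F # as) (g x)) \<and> r = F g)"
  by (subst kleene.simps) auto

lemma kleene_8_RFun_iff: "kleene (list_encode [8, d, c]) (RFun F # as) r \<longleftrightarrow>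
    (\<exists>g n. (\<forall>x. kleene d (Num x # RFun F # as) (g x)) \<and>
        kleene c (RFun F # as) n \<and> r = F g n)"
  by (subst kleene.simps) auto

lemma kleene_8_OpR_iff: "kleene (list_encode [8, d, c]) (OpR F # as) r \<longleftrightarrow>
    (\<exists>G n. (\<forall>h x. kleene d (Seq h # Num x # OpR F # as) (G h x)) \<and>
        kleene c (OpR F # as) n \<and> r = F G n)"
  by (subst kleene.simps) auto

lemma kleene_8_OpRR_iff: "kleene (list_encode [8, d, a, b, c]) (OpRR F # as) r \<longleftrightarrow>
    (\<exists>G u v n. (\<forall>h x. kleene d (Seq h # Num x # OpRR F # as) (G h x)) \<and>
        (\<forall>x. kleene a (Num x # OpRR F # as) (u x)) \<and>
        (\<forall>x. kleene b (Num x # OpRR F # as) (v x)) \<and>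
        kleene c (OpRR F # as) n \<and> r = F G u v n)"
  by (subst kleene.simps) auto

lemma kleene_8_OpNN_iff: "kleene (list_encode [8, d, b, c]) (OpNN F # as) r \<longleftrightarrow>
    (\<exists>G m n. (\<forall>h x. kleene d (Seq h # Num x # OpNN F # as) (G h x)) \<and>
        kleene b (OpNN F # as) m \<and> kleene c (OpNN F # as) n \<and> r = F G m n)"
  by (subst kleene.simps) auto

lemma kleene_9_iff: "kleene (list_encode [9, m]) (Num e # as) r \<longleftrightarrow>
    (m \<le> length as \<and> kleene e (take m as) r)"
  by (subst kleene.simps) auto

end

lemma kleene_functional: "kleene e as r \<Longrightarrow> \<forall>s. kleene e as s \<longrightarrow> s = r"
proof (induction rule: kleene.induct)
  case S1
  show ?case by (simp only: kleene_1_iff list.inject obj.inject) blast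
next
  case S3
  show ?case by (simp only: kleene_3_iff list.inject obj.inject) blast
next
  case S7
  show ?case by (simp only: kleene_7_iff list.inject obj.inject) blast
next
  case S2
  show ?case by (simp only: kleene_2_iff) blast
next
  case S4
  show ?case unfolding kleene_4_iff using S4.IH by metis
next
  case S5_0
  show ?case unfolding kleene_5_0_iff using S5_0.IH by metis
next
  case S5_Suc
  show ?case unfolding kleene_5_Suc_iff using S5_Suc.IH by metis
next
  case S6
  show ?case unfolding kleene_6_iff using S6.IH by metis
next
  case S9
  show ?case unfolding kleene_9_iff using S9.IH by metis
next
  case (S8_Fun2 d F as g)
  have 1: "\<forall>g'. (\<forall>x. kleene d (Num x # Fun2 F # as) (g' x)) \<longrightarrow> g' = g"
    using S8_Fun2.IH(1) by (simp add: fun_eq_iff)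
  show ?case unfolding kleene_8_Fun2_iff using 1 by metis
next
  case (S8_RFun d F as g c n)
  have 1: "\<forall>g'. (\<forall>x. kleene d (Num x # RFun F # as) (g' x)) \<longrightarrow> g' = g"
    using S8_RFun.IH(1) by (simp add: fun_eq_iff)
  have 2: "\<forall>s. kleene c (RFun F # as) s \<longrightarrow> s = n"
    by (rule S8_RFun.IH)
  show ?case unfolding kleene_8_RFun_iff using 1 2 by metis
next
  case (S8_OpR d F as G c n)
  have 1: "\<forall>G'. (\<forall>h x. kleene d (Seq h # Num x # OpR F # as) (G' h x)) \<longrightarrow> G' = G"
    using S8_OpR.IH(1) by (simp add: fun_eq_iff)
  have 2: "\<forall>s. kleene c (OpR F # as) s \<longrightarrow> s = n"
    by (rule S8_OpR.IH)
  show ?case unfolding kleene_8_OpR_iff using 1 2 by metis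
next
  case (S8_OpRR d F as G a u b v c n)
  have 1: "\<forall>G'. (\<forall>h x. kleene d (Seq h # Num x # OpRR F # as) (G' h x)) \<longrightarrow> G' = G"
    using S8_OpRR.IH(1) by (simp add: fun_eq_iff)
  have 2: "\<forall>u'. (\<forall>x. kleene a (Num x # OpRR F # as) (u' x)) \<longrightarrow> u' = u"
    using S8_OpRR.IH(2) by (simp add: fun_eq_iff)
  have 3: "\<forall>v'. (\<forall>x. kleene b (Num x # OpRR F # as) (v' x)) \<longrightarrow> v' = v"
    using S8_OpRR.IH(3) by (simp add: fun_eq_iff)
  have 4: "\<forall>s. kleene c (OpRR F # as) s \<longrightarrow> s = n"
    by (rule S8_OpRR.IH)
  show ?case unfolding kleene_8_OpRR_iff using 1 2 3 4 by metis
next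
  case (S8_OpNN d F as G b m c n)
  have 1: "\<forall>G'. (\<forall>h x. kleene d (Seq h # Num x # OpNN F # as) (G' h x)) \<longrightarrow> G' = G"
    using S8_OpNN.IH(1) by (simp add: fun_eq_iff)
  have 2: "\<forall>s. kleene b (OpNN F # as) s \<longrightarrow> s = m"
    by (rule S8_OpNN.IH)
  have 3: "\<forall>s. kleene c (OpNN F # as) s \<longrightarrow> s = n"
    by (rule S8_OpNN.IH)
  show ?case unfolding kleene_8_OpNN_iff using 1 2 3 by metis
qed

lemma kleene_deterministic: "kleene e as r \<Longrightarrow> kleene e as s \<Longrightarrow> r = s"
  using kleene_functional by blast


section \<open>The functionals deciding \<open>\<Sigma>\<^sup>1\<^sub>k\<close>-formulas\<close>

definition exists2 :: "(nat \<Rightarrow> nat) \<Rightarrow> nat" where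
  "exists2 f = (if \<exists>n. f n = 0 then 0 else 1)"

definition seg :: "(nat \<Rightarrow> nat) \<Rightarrow> nat \<Rightarrow> nat" where
  "seg g n = list_encode (map g [0..<n])"

text \<open>
  \<open>Sk k\<close> decides the Kleene normal form
  \<open>\<exists>g\<^sub>1 \<forall>g\<^sub>2 \<dots> Q g\<^sub>k. Q' n. f \<langle>seg g\<^sub>1 n, \<dots>, seg g\<^sub>k n\<rangle> = 0\<close> of \<open>\<Sigma>\<^sup>1\<^sub>k\<close>-formulas (all number and function
  parameters are merged into \<open>f\<close>), where the quantifier \<open>Q'\<close> is dual to \<open>Q\<close>: it is \<open>\<forall>\<close> for odd
  and \<open>\<exists>\<close> for even \<open>k\<close>.  Thus \<open>Sk 1\<close> is the Suslin functional; for \<open>k = 0\<close> there are no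
  function quantifiers and the tuple is \<open>n\<close>, so that \<open>Sk 0\<close> is \<open>exists2\<close>.
\<close>

fun segs :: "(nat \<Rightarrow> nat) list \<Rightarrow> nat \<Rightarrow> nat" where
  "segs [] n = n"
| "segs [g] n = seg g n"
| "segs (g # h # gs) n = prod_encode (seg g n, segs (h # gs) n)"

fun alternate :: "bool \<Rightarrow> nat \<Rightarrow> (nat \<Rightarrow> nat) list \<Rightarrow> ((nat \<Rightarrow> nat) list \<Rightarrow> bool) \<Rightarrow> bool" where
  "alternate b 0 gs M = M gs"
| "alternate True (Suc k) gs M = (\<exists>g. alternate False k (gs @ [g]) M)"
| "alternate False (Suc k) gs M = (\<forall>g. alternate True k (gs @ [g]) M)"

definition Sigma11_true :: "nat \<Rightarrow> (nat \<Rightarrow> nat) \<Rightarrow> bool" where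
  "Sigma11_true k f = alternate True k []
     (\<lambda>gs. if odd k then \<forall>n. f (segs gs n) = 0 else \<exists>n. f (segs gs n) = 0)"

definition Sk :: "nat \<Rightarrow> (nat \<Rightarrow> nat) \<Rightarrow> nat" where
  "Sk k f = (if Sigma11_true k f then 0 else 1)"

lemma Sk_0: "Sk 0 = exists2"
  by (auto simp: Sk_def Sigma11_true_def exists2_def)

lemma Sk_1: "Sk 1 f = 0 \<longleftrightarrow> (\<exists>g. \<forall>n. f (seg g n) = 0)"
  by (simp add: Sk_def Sigma11_true_def)

lemma Sk_2: "Sk 2 f = 0 \<longleftrightarrow> (\<exists>g. \<forall>h. \<exists>n. f (prod_encode (seg g n, seg h n)) = 0)"
  by (simp add: Sk_def Sigma11_true_def numeral_2_eq_2)


section \<open>Codes for reals, functions on the reals, and sets of reals\<close>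

text \<open>
  A real is coded by a sequence of (codes of) rationals with \<open>\<bar>q\<^sub>n - q\<^sub>n\<^sub>+\<^sub>1\<bar> < 2\<^sup>-\<^sup>n\<^sup>-\<^sup>1\<close>, hence
  \<open>\<bar>q\<^sub>n - q\<^sub>n\<^sub>+\<^sub>i\<bar> < 2\<^sup>-\<^sup>n\<close>.  As usual in higher-order arithmetic, Kohlenbach's hat operation, which
  freezes a sequence just before the condition first fails, makes every element of Baire space the
  code of a real.
\<close>

definition approx_fails :: "(nat \<Rightarrow> nat) \<Rightarrow> nat \<Rightarrow> bool" where
  "approx_fails \<alpha> k \<longleftrightarrow>
     \<not> \<bar>nat_to_rat_surj (\<alpha> k) - nat_to_rat_surj (\<alpha> (Suc k))\<bar> < (1/2) ^ Suc k"

definition hat :: "(nat \<Rightarrow> nat) \<Rightarrow> nat \<Rightarrow> rat" where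
  "hat \<alpha> n = nat_to_rat_surj
     (\<alpha> (if \<exists>k<n. approx_fails \<alpha> k then LEAST k. approx_fails \<alpha> k else n))"

definition rval :: "(nat \<Rightarrow> nat) \<Rightarrow> real" where
  "rval \<alpha> = lim (\<lambda>n. real_of_rat (hat \<alpha> n))"

lemma of_rat_abs_real: "real_of_rat \<bar>r\<bar> = \<bar>real_of_rat r\<bar>"
  by (simp add: abs_if of_rat_minus)

lemma hat_step: "\<bar>hat \<alpha> n - hat \<alpha> (Suc n)\<bar> < (1/2) ^ Suc n"
proof (cases "\<exists>k<n. approx_fails \<alpha> k")
  case True
  then have "\<exists>k<Suc n. approx_fails \<alpha> k" by (meson less_SucI)
  with True show ?thesis by (simp add: hat_def)
next
  case False
  show ?thesis
  proof (cases "approx_fails \<alpha> n")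
    case True
    with False have "(LEAST k. approx_fails \<alpha> k) = n"
      by (intro Least_equality) (auto simp: not_less)
    with True False show ?thesis by (auto simp: hat_def)
  next
    case nf: False
    with False have "\<not> (\<exists>k<Suc n. approx_fails \<alpha> k)" by (auto simp: less_Suc_eq)
    with False have "hat \<alpha> n = nat_to_rat_surj (\<alpha> n)"
      "hat \<alpha> (Suc n) = nat_to_rat_surj (\<alpha> (Suc n))" by (simp_all only: hat_def if_False)
    with nf show ?thesis by (simp only: approx_fails_def not_not)
  qed
qed

lemma hat_tendsto_rval: "(\<lambda>n. real_of_rat (hat \<alpha> n)) \<longlonglongrightarrow> rval \<alpha>"
proof -
  have step: "norm (real_of_rat (hat \<alpha> (Suc n)) - real_of_rat (hat \<alpha> n)) \<le> (1/2) ^ n" for n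
  proof -
    have "real_of_rat \<bar>hat \<alpha> n - hat \<alpha> (Suc n)\<bar> < real_of_rat ((1/2) ^ Suc n)"
      using hat_step[of \<alpha> n] by (simp only: of_rat_less)
    then have "\<bar>real_of_rat (hat \<alpha> n) - real_of_rat (hat \<alpha> (Suc n))\<bar> < (1/2) ^ Suc n"
      by (simp add: of_rat_abs_real of_rat_diff of_rat_power of_rat_divide of_rat_mult)
    also have "\<dots> \<le> (1/2) ^ n" by (simp add: field_simps)
    finally show ?thesis by (simp add: abs_minus_commute)
  qed
  have "summable (\<lambda>n. real_of_rat (hat \<alpha> (Suc n)) - real_of_rat (hat \<alpha> n))"
    by (rule summable_comparison_test'[OF summable_geometric[of "1/2::real"], of 0])
      (use step in auto)
  then have "convergent (\<lambda>n. real_of_rat (hat \<alpha> n))"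
    by (simp only: summable_iff_convergent
        sum_lessThan_telescope[where f = "\<lambda>n. real_of_rat (hat \<alpha> n)"]
        convergent_diff_const_right_iff)
  then show ?thesis unfolding rval_def by (simp add: convergent_LIMSEQ_iff)
qed

lemma surj_rval: "surj rval"
proof -
  have "\<exists>\<alpha>. rval \<alpha> = x" for x :: real
  proof -
    have "\<exists>m. \<bar>real_of_rat (nat_to_rat_surj m) - x\<bar> < (1/2) ^ (k + 2)" for k
    proof -
      have "x < x + (1/2) ^ (k + 2)" by simp
      from of_rat_dense[OF this] obtain r
        where r: "x < real_of_rat r" "real_of_rat r < x + (1/2) ^ (k + 2)" by blast
      obtain m where "nat_to_rat_surj m = r" by (metis surjD surj_nat_to_rat_surj)
      with r have "\<bar>real_of_rat (nat_to_rat_surj m) - x\<bar> < (1/2) ^ (k + 2)"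
        by (simp only: abs_less_iff) linarith
      then show ?thesis ..
    qed
    then obtain \<alpha> where \<alpha>: "\<And>k. \<bar>real_of_rat (nat_to_rat_surj (\<alpha> k)) - x\<bar> < (1/2) ^ (k + 2)"
      by metis
    have "\<not> approx_fails \<alpha> k" for k
    proof -
      have "\<bar>real_of_rat (nat_to_rat_surj (\<alpha> k)) - real_of_rat (nat_to_rat_surj (\<alpha> (Suc k)))\<bar>
          < (1/2) ^ (k + 2) + (1/2) ^ (Suc k + 2)"
        using \<alpha>[of k] \<alpha>[of "Suc k"] by linarith
      also have "\<dots> \<le> (1/2) ^ Suc k" by (simp add: field_simps)
      finally have "real_of_rat \<bar>nat_to_rat_surj (\<alpha> k) - nat_to_rat_surj (\<alpha> (Suc k))\<bar>
          < real_of_rat ((1/2) ^ Suc k)"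
        by (simp add: of_rat_abs_real of_rat_diff of_rat_power of_rat_divide of_rat_mult)
      then show ?thesis by (simp only: of_rat_less approx_fails_def not_not)
    qed
    then have hat: "hat \<alpha> = (\<lambda>n. nat_to_rat_surj (\<alpha> n))" by (auto simp: hat_def)
    have "(\<lambda>k. (1/2::real) ^ (k + 2)) \<longlonglongrightarrow> 0"
      by (intro LIMSEQ_ignore_initial_segment LIMSEQ_realpow_zero) auto
    then have "(\<lambda>k. real_of_rat (nat_to_rat_surj (\<alpha> k)) - x) \<longlonglongrightarrow> 0"
      by (rule Lim_null_comparison[rotated])
        (use \<alpha> in \<open>intro always_eventually allI, simp only: real_norm_def less_imp_le\<close>)
    then have "(\<lambda>k. real_of_rat (hat \<alpha> k)) \<longlonglongrightarrow> x" by (simp add: hat LIM_zero_iff)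
    then show ?thesis using hat_tendsto_rval LIMSEQ_unique by blast
  qed
  then show ?thesis unfolding surj_def by metis
qed

definition codes_fun :: "((nat \<Rightarrow> nat) \<Rightarrow> nat \<Rightarrow> nat) \<Rightarrow> (real \<Rightarrow> real) \<Rightarrow> bool" where
  "codes_fun F f \<longleftrightarrow> (\<forall>\<alpha>. rval (F \<alpha>) = f (rval \<alpha>))"

definition set_code :: "real set \<Rightarrow> (nat \<Rightarrow> nat) \<Rightarrow> nat" where
  "set_code A \<alpha> = (if rval \<alpha> \<in> A then 1 else 0)"

definition natfun_code :: "(real \<Rightarrow> nat) \<Rightarrow> (nat \<Rightarrow> nat) \<Rightarrow> nat" where
  "natfun_code Y \<alpha> = Y (rval \<alpha>)"

definition rat_interval :: "nat \<Rightarrow> real set" where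
  "rat_interval c = (case prod_decode c of (i, j) \<Rightarrow>
     {real_of_rat (nat_to_rat_surj i) <..< real_of_rat (nat_to_rat_surj j)})"


section \<open>Computability of third-order functionals\<close>

text \<open>
  \<open>os\<close> is the list of oracles.  The inputs range over all codes of elements of the domain,
  e.g. of functions \<open>\<real> \<rightarrow> \<real>\<close>.
\<close>

definition computable_R ::
    "obj list \<Rightarrow> (((nat \<Rightarrow> nat) \<Rightarrow> nat \<Rightarrow> nat) \<Rightarrow> nat \<Rightarrow> nat) \<Rightarrow> bool" where
  "computable_R os \<Phi> \<longleftrightarrow>
     (\<exists>e. \<forall>F f n. codes_fun F f \<longrightarrow> kleene e (os @ [RFun F, Num n]) (\<Phi> F n))"

definition computable_RR ::
    "obj list \<Rightarrow> (((nat \<Rightarrow> nat) \<Rightarrow> nat \<Rightarrow> nat) \<Rightarrow> (nat \<Rightarrow> nat) \<Rightarrow> (nat \<Rightarrow> nat) \<Rightarrow> nat \<Rightarrow> nat) \<Rightarrow> bool"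
  where
  "computable_RR os \<Psi> \<longleftrightarrow>
     (\<exists>e. \<forall>F f \<alpha> \<beta> n. codes_fun F f \<longrightarrow>
        kleene e (os @ [RFun F, Seq \<alpha>, Seq \<beta>, Num n]) (\<Psi> F \<alpha> \<beta> n))"

definition computable_NN ::
    "obj list \<Rightarrow> (((nat \<Rightarrow> nat) \<Rightarrow> nat \<Rightarrow> nat) \<Rightarrow> nat \<Rightarrow> nat \<Rightarrow> nat) \<Rightarrow> bool" where
  "computable_NN os \<zeta> \<longleftrightarrow>
     (\<exists>e. \<forall>F f m n. codes_fun F f \<longrightarrow> kleene e (os @ [RFun F, Num m, Num n]) (\<zeta> F m n))"

definition computable_cantor ::
    "obj list \<Rightarrow> (((nat \<Rightarrow> nat) \<Rightarrow> nat) \<Rightarrow> ((nat \<Rightarrow> nat) \<Rightarrow> nat) \<Rightarrow> nat \<Rightarrow> nat) \<Rightarrow> bool" where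
  "computable_cantor os \<Theta> \<longleftrightarrow>
     (\<exists>e. \<forall>A Y n. kleene e (os @ [Fun2 (set_code A), Fun2 (natfun_code Y), Num n])
                         (\<Theta> (set_code A) (natfun_code Y) n))"


section \<open>Cliquish functions and the functionals\<close>

definition cliquish_at :: "(real \<Rightarrow> real) \<Rightarrow> real \<Rightarrow> bool" where
  "cliquish_at f x0 \<longleftrightarrow>
     (\<forall>\<epsilon>>0. \<forall>U. openin (top_of_set {0..1}) U \<and> x0 \<in> U \<longrightarrow>
        (\<exists>G. openin (top_of_set {0..1}) G \<and> G \<noteq> {} \<and> G \<subseteq> U \<and> (\<forall>x\<in>G. \<forall>y\<in>G. \<bar>f x - f y\<bar> < \<epsilon>)))"

definition cliquish_unit :: "(real \<Rightarrow> real) \<Rightarrow> bool" where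
  "cliquish_unit f \<longleftrightarrow> f \<in> {0..1} \<rightarrow> {0..1} \<and> (\<forall>x\<in>{0..1}. cliquish_at f x)"

definition cont_points :: "(real \<Rightarrow> real) \<Rightarrow> real set" where
  "cont_points f = {x \<in> {0..1}. continuous (at x within {0..1}) f}"

text \<open>
  Functionals on \<open>\<real> \<rightarrow> \<real>\<close> act on codes; the result may depend on the code of \<open>f\<close>.
  A function \<open>[0,1] \<rightarrow> [0,1]\<close> is given by any of its extensions to \<open>\<real>\<close>.
\<close>

definition cont_point_functional :: "(((nat \<Rightarrow> nat) \<Rightarrow> nat \<Rightarrow> nat) \<Rightarrow> nat \<Rightarrow> nat) \<Rightarrow> bool" where
  "cont_point_functional \<Phi> \<longleftrightarrow>
     (\<forall>F f. codes_fun F f \<and> cliquish_unit f \<longrightarrow> rval (\<Phi> F) \<in> cont_points f)"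

definition sup_functional ::
    "(((nat \<Rightarrow> nat) \<Rightarrow> nat \<Rightarrow> nat) \<Rightarrow> (nat \<Rightarrow> nat) \<Rightarrow> (nat \<Rightarrow> nat) \<Rightarrow> nat \<Rightarrow> nat) \<Rightarrow> bool" where
  "sup_functional \<Psi> \<longleftrightarrow>
     (\<forall>F f \<alpha> \<beta>. codes_fun F f \<and> cliquish_unit f \<and> 0 \<le> rval \<alpha> \<and> rval \<alpha> \<le> rval \<beta> \<and> rval \<beta> \<le> 1 \<longrightarrow>
        rval (\<Psi> F \<alpha> \<beta>) = (SUP x\<in>{rval \<alpha>..rval \<beta>}. f x))"

definition Gdelta_functional :: "(((nat \<Rightarrow> nat) \<Rightarrow> nat \<Rightarrow> nat) \<Rightarrow> nat \<Rightarrow> nat \<Rightarrow> nat) \<Rightarrow> bool" where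
  "Gdelta_functional \<zeta> \<longleftrightarrow>
     (\<forall>F f. codes_fun F f \<and> cliquish_unit f \<longrightarrow>
        cont_points f = (\<Inter>n. \<Union>m. rat_interval (\<zeta> F m n)))"

text \<open>The value is required to lie in \<open>[0,1]\<close>: otherwise the constant 2 would qualify.\<close>

definition cantor_realiser ::
    "(((nat \<Rightarrow> nat) \<Rightarrow> nat) \<Rightarrow> ((nat \<Rightarrow> nat) \<Rightarrow> nat) \<Rightarrow> nat \<Rightarrow> nat) \<Rightarrow> bool" where
  "cantor_realiser \<Theta> \<longleftrightarrow>
     (\<forall>A Y. A \<subseteq> {0..1} \<and> A \<noteq> {} \<and> inj_on Y A \<longrightarrow>
        rval (\<Theta> (set_code A) (natfun_code Y)) \<in> {0..1} - A)"

end

theory Submission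
  imports Defs
begin

text \<open>
  If \<open>Y\<close> is injective on \<open>A\<close>, then the function with value \<open>1 / (Y x + 1)\<close> at \<open>x \<in> A\<close> and \<open>0\<close>
  elsewhere is cliquish and continuous exactly off \<open>A\<close>.

  For the negative part, fix a type-2 functional \<open>H\<close>.  A computation from \<open>H\<close> and such a function
  only ever mentions numbers, \<open>H\<close> and the function itself, so it has countably many possible
  indices.  Consider partial maps from reals to indices that assign to a real an index which computes
  it using only the part of the function already described by the map.  By Zorn's lemma there is a
  maximal one; it is injective since computations are deterministic, and its domain \<open>A\<close> contains
  everything that is computable from \<open>H\<close> and the resulting function.  A continuity point, which lies
  outside \<open>A\<close>, can then not be computed, and the suprema over rational intervals or a \<open>G\<^sub>\<delta>\<close>
  representation would determine one.

  For the positive part, (a) is immediate from the same function.  With (b) or (c) applied to the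
  indicator of \<open>{x \<in> A. Y x = k}\<close>, which has at most one element, one decides whether
  that element lies in a given rational interval; choosing for every \<open>k\<close> an outer third of the current
  interval that misses it yields a point of the Cantor set outside \<open>A\<close>.
\<close>

declare list_encode.simps [simp del]

section \<open>Spike functions\<close>

text \<open>\<open>int_decode\<close> sends an even number 2n to n, so doubling both components
  gives a code of the quotient of the naturals \<open>w\<close> and \<open>d\<close>.\<close>

definition rat_code :: "nat \<Rightarrow> nat \<Rightarrow> nat" where
  "rat_code w d = prod_encode (2 * w, 2 * d)"

lemma nat_to_rat_surj_rat_code: "nat_to_rat_surj (rat_code w d) = of_nat w / of_nat d"
proof -
  have *: "int_decode (2 * n) = int n" for n
    by (simp add: int_decode_def sum_decode_def)
  show ?thesis
    by (simp add: nat_to_rat_surj_def rat_code_def * Fract_of_int_quotient)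
qed

lemma rval_eqI:
  assumes "\<And>k. \<not> approx_fails \<alpha> k"
    and "(\<lambda>n. real_of_rat (nat_to_rat_surj (\<alpha> n))) \<longlonglongrightarrow> x"
  shows "rval \<alpha> = x"
proof -
  have "hat \<alpha> = (\<lambda>n. nat_to_rat_surj (\<alpha> n))" using assms(1) by (auto simp: hat_def)
  with assms(2) hat_tendsto_rval[of \<alpha>] show ?thesis using LIMSEQ_unique by metis
qed

lemma rval_const: "rval (\<lambda>_. c) = real_of_rat (nat_to_rat_surj c)"
  by (rule rval_eqI) (auto simp: approx_fails_def)

lemma rval_rat_code: "rval (\<lambda>_. rat_code w d) = real w / real d"
  by (simp add: rval_const nat_to_rat_surj_rat_code of_rat_divide)

text \<open>A variant of Thomae's function, with \<open>A\<close> in place of the rationals and the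
  enumeration \<open>Y\<close> in place of the denominators.\<close>

definition spike :: "real set \<Rightarrow> (real \<Rightarrow> nat) \<Rightarrow> real \<Rightarrow> real" where
  "spike A Y x = (if x \<in> A then 1 / real (Suc (Y x)) else 0)"

text \<open>The arguments are the coded characteristic function and the coded \<open>Y\<close>, so
  that the code is primitive recursive in them. All values are rational, hence coded by constant
  sequences: \<open>n\<close> does not occur on the right.\<close>

definition spike_code ::
    "((nat \<Rightarrow> nat) \<Rightarrow> nat) \<Rightarrow> ((nat \<Rightarrow> nat) \<Rightarrow> nat) \<Rightarrow> (nat \<Rightarrow> nat) \<Rightarrow> nat \<Rightarrow> nat" where
  "spike_code a y \<alpha> n = rat_code (if a \<alpha> = 1 then 1 else 0) (Suc (y \<alpha>))"

lemma codes_fun_spike: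
  "codes_fun (spike_code (set_code A) (natfun_code Y)) (spike A Y)"
proof -
  have "rval (\<lambda>n. rat_code w d) = real w / real d" for w d by (rule rval_rat_code)
  then show ?thesis
    by (auto simp: codes_fun_def spike_code_def[abs_def] spike_def set_code_def natfun_code_def)
qed

lemma spike_bounds: "0 \<le> spike A Y x" "spike A Y x \<le> 1"
  by (auto simp: spike_def field_simps)

lemma spike_pos_iff: "spike A Y x > 0 \<longleftrightarrow> x \<in> A"
  by (auto simp: spike_def)

text \<open>A value of at least \<open>e\<close> forces \<open>x\<close> into \<open>A\<close> and
  bounds \<open>Y x\<close>; injectivity of \<open>Y\<close> leaves only finitely many such
  points.\<close>

lemma finite_spike_ge:
  assumes "inj_on Y A" "e > 0"
  shows "finite {x. spike A Y x \<ge> e}"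
proof -
  obtain N :: nat where N: "1 / e < N" using reals_Archimedean2 by blast
  have "Y x < N" "x \<in> A" if "spike A Y x \<ge> e" for x
  proof -
    show "x \<in> A" using that \<open>e > 0\<close> by (auto simp: spike_def split: if_splits)
    then have "e \<le> 1 / real (Suc (Y x))" using that by (simp add: spike_def)
    then have "e * real (Suc (Y x)) \<le> 1" by (simp add: field_simps)
    moreover have "1 < e * N" using N \<open>e > 0\<close> by (simp add: field_simps)
    ultimately have "e * real (Suc (Y x)) < e * N" by linarith
    then show "Y x < N" using \<open>e > 0\<close> by simp
  qed
  then have "{x. spike A Y x \<ge> e} \<subseteq> {x \<in> A. Y x < N}" by auto
  moreover have "finite {x \<in> A. Y x < N}"
  proof (rule inj_on_finite)
    show "inj_on Y {x \<in> A. Y x < N}" using assms(1) by (auto simp: inj_on_def)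
    show "Y ` {x \<in> A. Y x < N} \<subseteq> {..<N}" by auto
  qed simp
  ultimately show ?thesis by (rule finite_subset)
qed

lemma countable_of_inj: "inj_on (Y :: real \<Rightarrow> nat) A \<Longrightarrow> countable A"
  by (rule countableI)

text \<open>\<open>A\<close> is countable because \<open>Y\<close> injects it into the naturals,
  while a nondegenerate interval is uncountable.\<close>

lemma ex_notin_interval:
  assumes "inj_on (Y :: real \<Rightarrow> nat) A" "p < q"
  shows "\<exists>x\<in>{p<..<q}. x \<notin> A"
proof (rule ccontr)
  assume "\<not> ?thesis"
  then have "{p<..<q} \<subseteq> A" by auto
  then have "countable {p<..<q}" using countable_of_inj[OF assms(1)] countable_subset by blast
  then show False using uncountable_open_interval[of p q] assms(2) by simp
qed

text \<open>The interval found need not contain \<open>x\<close>: this covers the endpoints 0 and 1,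
  which are not interior to the unit interval in the line.\<close>

lemma openin_unit_meets_interval:
  assumes "openin (top_of_set {0..1::real}) U" "x \<in> U"
  obtains p q where "p < q" "{p<..<q} \<subseteq> U"
proof -
  obtain T where T: "open T" "U = {0..1} \<inter> T" using assms(1) by (auto simp: openin_open)
  then have x: "x \<in> T" "0 \<le> x" "x \<le> 1" using assms(2) by auto
  then obtain e where e: "e > 0" "\<And>y. \<bar>y - x\<bar> < e \<Longrightarrow> y \<in> T"
    using T(1) by (auto simp: open_real)
  show thesis
  proof
    show "max 0 (x - e) < min 1 (x + e)" using e(1) x by auto
    show "{max 0 (x - e)<..<min 1 (x + e)} \<subseteq> U" using e(2) T(2) by auto
  qed
qed

lemma cliquish_spike:
  assumes "inj_on Y A"
  shows "cliquish_unit (spike A Y)"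
  unfolding cliquish_unit_def cliquish_at_def
proof (intro conjI ballI allI impI)
  show "spike A Y \<in> {0..1} \<rightarrow> {0..1}" using spike_bounds by auto
next
  fix x \<epsilon> :: real and U assume "0 < \<epsilon>" and U: "openin (top_of_set {0..1}) U \<and> x \<in> U"
  \<comment> \<open>Deleting the finite set \<open>E\<close> from \<open>U\<close> leaves a nonempty
    relatively open set on which all values lie between 0 and \<epsilon>.\<close>
  define E where "E = {x. spike A Y x \<ge> \<epsilon>}"
  have fin: "finite E" unfolding E_def by (rule finite_spike_ge[OF assms \<open>0 < \<epsilon>\<close>])
  obtain p q where pq: "p < q" "{p<..<q} \<subseteq> U" using U openin_unit_meets_interval by metis
  have "infinite {p<..<q}" using pq(1) by simp
  then have "\<not> {p<..<q} \<subseteq> E" using fin finite_subset by blast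
  then have "U - E \<noteq> {}" using pq(2) by auto
  moreover have "U - E = U \<inter> (- E)" by auto
  moreover have "openin (top_of_set {0..1}) (U \<inter> (- E))"
    using U fin by (intro openin_Int_open) (auto simp: finite_imp_closed)
  moreover have "\<bar>spike A Y y - spike A Y z\<bar> < \<epsilon>" if "y \<in> U - E" "z \<in> U - E" for y z
  proof -
    have "spike A Y y < \<epsilon>" "spike A Y z < \<epsilon>" using that by (auto simp: E_def)
    then show ?thesis using spike_bounds(1)[of A Y y] spike_bounds(1)[of A Y z] by linarith
  qed
  ultimately show "\<exists>G. openin (top_of_set {0..1}) G \<and> G \<noteq> {} \<and> G \<subseteq> U \<and>
      (\<forall>x\<in>G. \<forall>y\<in>G. \<bar>spike A Y x - spike A Y y\<bar> < \<epsilon>)"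
    by (intro exI[of _ "U - E"]) auto
qed

text \<open>Only finitely many points carry values of at least \<open>e\<close>, and
  \<open>x\<close> is not one of them, so a neighbourhood of \<open>x\<close> avoids them
  all.\<close>

lemma spike_small_near:
  assumes "inj_on Y A" "x \<notin> A" "e > 0"
  obtains d where "d > 0" "\<And>y. \<bar>y - x\<bar> < d \<Longrightarrow> spike A Y y < e"
proof -
  define E where "E = {x. spike A Y x \<ge> e}"
  have "finite E" unfolding E_def by (rule finite_spike_ge[OF assms(1,3)])
  then have "open (- E)" using finite_imp_closed by auto
  moreover have "x \<in> - E" using assms by (simp add: E_def spike_def)
  ultimately obtain d where "d > 0" "\<And>y. \<bar>y - x\<bar> < d \<Longrightarrow> y \<in> - E"
    unfolding open_real by blast
  then show thesis by (intro that) (auto simp: E_def not_le)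
qed

text \<open>Off \<open>A\<close> the value is 0 and nearby values are small. At a point of
  \<open>A\<close> the value is positive, while zeros of the function are dense since
  \<open>A\<close> contains no interval.\<close>

lemma cont_points_spike:
  assumes "inj_on Y A"
  shows "cont_points (spike A Y) = {0..1} - A"
proof (intro equalityI subsetI)
  fix x assume "x \<in> {0..1} - A"
  moreover have "\<exists>d>0. \<forall>y\<in>{0..1}. \<bar>y - x\<bar> < d \<longrightarrow> \<bar>spike A Y y - spike A Y x\<bar> < e"
    if *: "x \<notin> A" "e > 0" for e
  proof -
    obtain d where "d > 0" "\<And>y. \<bar>y - x\<bar> < d \<Longrightarrow> spike A Y y < e"
      using spike_small_near[OF assms *] by metis
    moreover have "spike A Y x = 0" using *(1) by (simp add: spike_def)
    ultimately show ?thesis using spike_bounds(1)[of A Y] by (metis abs_of_nonneg diff_zero)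
  qed
  ultimately show "x \<in> cont_points (spike A Y)"
    by (auto simp: cont_points_def continuous_within_eps_delta dist_real_def)
next
  fix x assume x: "x \<in> cont_points (spike A Y)"
  then have x01: "x \<in> {0..1}" by (simp add: cont_points_def)
  have "x \<notin> A"
  proof
    assume "x \<in> A"
    then have "spike A Y x > 0" by (simp add: spike_pos_iff)
    then obtain d where d: "d > 0"
      "\<And>y. y \<in> {0..1} \<Longrightarrow> \<bar>y - x\<bar> < d \<Longrightarrow> \<bar>spike A Y y - spike A Y x\<bar> < spike A Y x"
      using x unfolding cont_points_def continuous_within_eps_delta dist_real_def
      by blast
    have "max 0 (x - d) < min 1 (x + d)" using x01 d(1) by auto
    then obtain y where y: "y \<in> {max 0 (x - d)<..<min 1 (x + d)}" "y \<notin> A"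
      using ex_notin_interval[OF assms] by blast
    then have "\<bar>spike A Y y - spike A Y x\<bar> < spike A Y x" by (intro d(2)) auto
    moreover have "spike A Y y = 0" using y(2) by (simp add: spike_def)
    ultimately show False using \<open>spike A Y x > 0\<close> by simp
  qed
  then show "x \<in> {0..1} - A" using x01 by simp
qed

section \<open>Closure under partial computations\<close>

text \<open>The arguments of the computations from \<open>H\<close> and a function on the reals; constant sequences serve
  as codes of the rational endpoints in (b).  In \<open>P8_Real\<close> the function is only consulted where \<open>P\<close>
  already has an index.\<close>

datatype tok = TNum nat | TFun | TReal | TConst nat

instance tok :: countable by countable_datatype

fun obj_of :: "((nat \<Rightarrow> nat) \<Rightarrow> nat) \<Rightarrow> ((nat \<Rightarrow> nat) \<Rightarrow> nat \<Rightarrow> nat) \<Rightarrow> tok \<Rightarrow> obj" where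
  "obj_of H F (TNum n) = Num n"
| "obj_of H F TFun = Fun2 H"
| "obj_of H F TReal = RFun F"
| "obj_of H F (TConst i) = Seq (\<lambda>_. i)"

text \<open>The schemes of \<open>kleene\<close> on token lists. A query at a real with index
  \<open>k\<close> is answered by the code of 1/(k+1); the position \<open>n\<close> must be
  computed but does not affect the answer, as the codes of the values are constant sequences.
  \<open>P\<close> occurs only positively, which makes the relation monotone in
  \<open>P\<close>.\<close>

inductive pkleene :: "((nat \<Rightarrow> nat) \<Rightarrow> nat) \<Rightarrow> (real \<times> nat) set \<Rightarrow> nat \<Rightarrow> tok list \<Rightarrow> nat \<Rightarrow> bool"
  for H P where
  P1: "pkleene H P (list_encode [1]) (TNum a # as) (Suc a)"
| P2: "pkleene H P (list_encode [2, q]) as q"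
| P3: "pkleene H P (list_encode [3]) (TNum a # as) a"
| P4: "\<lbrakk>pkleene H P d as s; pkleene H P c (TNum s # as) r\<rbrakk>
    \<Longrightarrow> pkleene H P (list_encode [4, c, d]) as r"
| P5_0: "pkleene H P c as r \<Longrightarrow> pkleene H P (list_encode [5, c, d]) (TNum 0 # as) r"
| P5_Suc: "\<lbrakk>pkleene H P (list_encode [5, c, d]) (TNum a # as) s;
      pkleene H P d (TNum a # TNum s # as) r\<rbrakk>
    \<Longrightarrow> pkleene H P (list_encode [5, c, d]) (TNum (Suc a) # as) r"
| P6: "\<lbrakk>distinct p; set p = {..<length as}; pkleene H P d (map (\<lambda>i. as ! i) p) r\<rbrakk>
    \<Longrightarrow> pkleene H P (list_encode [6, d, list_encode p]) as r"
| P7: "pkleene H P (list_encode [7]) (TNum a # TConst i # as) i"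
| P8_Fun: "\<lbrakk>\<And>x. pkleene H P d (TNum x # TFun # as) (g x)\<rbrakk>
    \<Longrightarrow> pkleene H P (list_encode [8, d]) (TFun # as) (H g)"
| P8_Real: "\<lbrakk>\<And>x. pkleene H P d (TNum x # TReal # as) (g x); pkleene H P c (TReal # as) n;
      (rval g, k) \<in> P\<rbrakk>
    \<Longrightarrow> pkleene H P (list_encode [8, d, c]) (TReal # as) (rat_code 1 (Suc k))"
| P9: "\<lbrakk>m \<le> length as; pkleene H P e (take m as) r\<rbrakk>
    \<Longrightarrow> pkleene H P (list_encode [9, m]) (TNum e # as) r"

lemma pkleene_mono:
  assumes "pkleene H P e as r" "P \<subseteq> Q"
  shows "pkleene H Q e as r"
  using assms(1)
proof induction
  case (P8_Real d as g c n k)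
  then show ?case using assms(2) by (intro pkleene.P8_Real[where g = g and n = n]) auto
qed (rule pkleene.intros; assumption)+

text \<open>Soundness: a partial computation is a genuine one for every \<open>F\<close> that gives
  the answers recorded in \<open>P\<close>, since no other values of \<open>F\<close> are
  consulted.\<close>

lemma pkleene_imp_kleene:
  assumes "pkleene H P e as r"
    and F: "\<And>g k n. (rval g, k) \<in> P \<Longrightarrow> F g n = rat_code 1 (Suc k)"
  shows "kleene e (map (obj_of H F) as) r"
  using assms(1)
proof induction
  case (P6 p as d r)
  have "map (obj_of H F) (map ((!) as) p) = map ((!) (map (obj_of H F) as)) p"
    using P6.hyps(2) by (simp add: nth_map)
  then have "kleene d (map ((!) (map (obj_of H F) as)) p) r" using P6.IH by metis
  moreover have "set p = {..<length (map (obj_of H F) as)}" using P6.hyps(2) by simp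
  ultimately show ?case by (rule kleene.S6[OF P6.hyps(1), rotated])
next
  case (P8_Real d as g c n k)
  then have "kleene (list_encode [8, d, c]) (RFun F # map (obj_of H F) as) (F g n)"
    by (intro kleene.S8_RFun) simp_all
  with F[OF P8_Real.hyps(3)] show ?case by simp
next
  case (P9 m as e r)
  then have "kleene e (take m (map (obj_of H F) as)) r" by (simp add: take_map)
  then show ?case using P9.hyps(1) by (auto intro: kleene.S9)
next
  case (P7 a i as)
  show ?case using kleene.S7[of a "\<lambda>_. i"] by simp
next
  case (P4 d as s c r)
  then show ?case by (auto intro: kleene.S4)
next
  case (P8_Fun d as g)
  then show ?case by (auto intro: kleene.S8_Fun2)
next
  case (P5_Suc c d a as s r)
  then show ?case by (auto intro: kleene.S5_Suc)
next
  case (P1 a as)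
  show ?case unfolding list.map obj_of.simps by (rule kleene.S1)
qed (auto intro: kleene.S2 kleene.S3 kleene.S5_0)

text \<open>Inversion rules for argument lists that come from tokens. The last three make the S8
  cases for operators vacuous in the next induction.\<close>

lemma Cons_eq_map_obj_of:
  "Num a # bs = map (obj_of H F) as \<longleftrightarrow> (\<exists>cs. as = TNum a # cs \<and> bs = map (obj_of H F) cs)"
  "Fun2 K # bs = map (obj_of H F) as \<longleftrightarrow> (\<exists>cs. as = TFun # cs \<and> K = H \<and> bs = map (obj_of H F) cs)"
  "RFun G # bs = map (obj_of H F) as \<longleftrightarrow> (\<exists>cs. as = TReal # cs \<and> G = F \<and> bs = map (obj_of H F) cs)"
  "Seq f # bs = map (obj_of H F) as \<longleftrightarrow>
     (\<exists>i cs. as = TConst i # cs \<and> f = (\<lambda>_. i) \<and> bs = map (obj_of H F) cs)"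
  "OpR K1 # bs \<noteq> map (obj_of H F) as"
  "OpRR K2 # bs \<noteq> map (obj_of H F) as"
  "OpNN K3 # bs \<noteq> map (obj_of H F) as"
  by (cases as; simp; cases "hd as"; auto)+

text \<open>Converse of soundness. By \<open>closed\<close>, every real at which the function is
  queried already has an index, so \<open>P8_Real\<close> applies to each such query. The token list
  is quantified in the conclusion because it changes along the induction.\<close>

lemma kleene_imp_pkleene:
  assumes "kleene e bs r"
    and F: "\<And>g k n. (rval g, k) \<in> P \<Longrightarrow> F g n = rat_code 1 (Suc k)"
    and closed: "\<And>d as g. (\<And>x. pkleene H P d (TNum x # TReal # as) (g x)) \<Longrightarrow> \<exists>k. (rval g, k) \<in> P"
  shows "\<forall>as. bs = map (obj_of H F) as \<longrightarrow> pkleene H P e as r"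
  using assms(1)
proof (induction rule: kleene.induct)
  case (S1 a bs)
  show ?case unfolding Cons_eq_map_obj_of using pkleene.P1 by blast
next
  case (S2 q bs)
  show ?case using pkleene.P2 by blast
next
  case (S3 a bs)
  show ?case unfolding Cons_eq_map_obj_of using pkleene.P3 by blast
next
  case (S4 d bs s c r)
  show ?case
  proof (intro allI impI)
    fix as assume "bs = map (obj_of H F) as"
    then have "pkleene H P d as s" "pkleene H P c (TNum s # as) r"
      using S4.IH by (simp_all add: Cons_eq_map_obj_of)
    then show "pkleene H P (list_encode [4, c, d]) as r" by (rule pkleene.P4)
  qed
next
  case (S5_0 c bs r d)
  then show ?case unfolding Cons_eq_map_obj_of using pkleene.P5_0 by blast
next
  case (S5_Suc c d a bs s r)
  show ?case
  proof (intro allI impI)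
    fix as assume "Num (Suc a) # bs = map (obj_of H F) as"
    then obtain cs where as: "as = TNum (Suc a) # cs" "bs = map (obj_of H F) cs"
      by (auto simp: Cons_eq_map_obj_of)
    then have "pkleene H P (list_encode [5, c, d]) (TNum a # cs) s"
      "pkleene H P d (TNum a # TNum s # cs) r"
      using S5_Suc.IH by (simp_all add: Cons_eq_map_obj_of)
    then show "pkleene H P (list_encode [5, c, d]) as r" unfolding as by (rule pkleene.P5_Suc)
  qed
next
  case (S6 p bs d r)
  show ?case
  proof (intro allI impI)
    fix as assume bs: "bs = map (obj_of H F) as"
    have p: "set p = {..<length as}" using S6.hyps(2) bs by simp
    have "map (\<lambda>i. bs ! i) p = map (obj_of H F) (map (\<lambda>i. as ! i) p)"
      unfolding bs using p by (simp add: nth_map)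
    then have "pkleene H P d (map (\<lambda>i. as ! i) p) r" using S6.IH by blast
    with S6.hyps(1) p show "pkleene H P (list_encode [6, d, list_encode p]) as r"
      by (rule pkleene.P6)
  qed
next
  case (S7 a f bs)
  show ?case unfolding Cons_eq_map_obj_of using pkleene.P7 by blast
next
  case (S8_Fun2 d K bs g)
  show ?case
  proof (intro allI impI)
    fix as assume "Fun2 K # bs = map (obj_of H F) as"
    then obtain cs where as: "as = TFun # cs" "bs = map (obj_of H F) cs" "K = H"
      by (auto simp: Cons_eq_map_obj_of)
    then have "pkleene H P d (TNum x # TFun # cs) (g x)" for x
      using S8_Fun2.IH by (simp add: Cons_eq_map_obj_of)
    then show "pkleene H P (list_encode [8, d]) as (K g)"
      unfolding as by (rule pkleene.P8_Fun)
  qed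
next
  case (S8_RFun d G bs g c n)
  show ?case
  proof (intro allI impI)
    fix as assume "RFun G # bs = map (obj_of H F) as"
    then obtain cs where as: "as = TReal # cs" "bs = map (obj_of H F) cs" "G = F"
      by (auto simp: Cons_eq_map_obj_of)
    then have g: "pkleene H P d (TNum x # TReal # cs) (g x)" for x
      using S8_RFun.IH by (simp add: Cons_eq_map_obj_of)
    have n: "pkleene H P c (TReal # cs) n"
      using S8_RFun.IH as by (simp add: Cons_eq_map_obj_of)
    obtain k where k: "(rval g, k) \<in> P" using closed[OF g] by blast
    show "pkleene H P (list_encode [8, d, c]) as (G g n)"
      unfolding as F[OF k] using g n k by (rule pkleene.P8_Real)
  qed
next
  case (S9 m bs e r)
  show ?case
  proof (intro allI impI)
    fix as assume "Num e # bs = map (obj_of H F) as"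
    then obtain cs where as: "as = TNum e # cs" "bs = map (obj_of H F) cs"
      by (auto simp: Cons_eq_map_obj_of)
    have "pkleene H P e (take m cs) r" using S9.IH as(2) by (simp add: take_map)
    moreover have "m \<le> length cs" using S9.hyps(1) as(2) by simp
    ultimately show "pkleene H P (list_encode [9, m]) as r" unfolding as by (intro pkleene.P9)
  qed
qed (simp_all only: Cons_eq_map_obj_of simp_thms)

section \<open>Maximal partial maps from reals to indices\<close>

text \<open>The two ways in which a real can be computed: as an argument at which the function is
  queried, or as the result of a whole computation. Configurations are countable, and their numbers
  serve as the indices.\<close>

datatype config = Query nat "tok list" | Result nat

instance config :: countable by countable_datatype

text \<open>For a result, \<open>args i\<close> is the argument list on which the output value
  number \<open>i\<close> is computed, and \<open>T\<close> reads a real off the complete output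
  sequence.\<close>

fun computes :: "(nat \<Rightarrow> tok list) \<Rightarrow> ((nat \<Rightarrow> nat) \<Rightarrow> real) \<Rightarrow> ((nat \<Rightarrow> nat) \<Rightarrow> nat) \<Rightarrow>
    (real \<times> nat) set \<Rightarrow> config \<Rightarrow> real \<Rightarrow> bool" where
  "computes args T H P (Query d as) x \<longleftrightarrow>
     (\<exists>g. (\<forall>i. pkleene H P d (TNum i # TReal # as) (g i)) \<and> x = rval g)"
| "computes args T H P (Result e) x \<longleftrightarrow>
     (\<exists>g. (\<forall>i. pkleene H P e (args i) (g i)) \<and> x = T g)"

lemma computes_mono:
  assumes "computes args T H P c x" "P \<subseteq> Q"
  shows "computes args T H Q c x"
  using assms by (cases c) (auto intro: pkleene_mono)

text \<open>The total function described by \<open>P\<close>: the spike function on its domain, with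
  the assigned index as \<open>Y\<close>.\<close>

definition graph_code :: "(real \<times> nat) set \<Rightarrow> (nat \<Rightarrow> nat) \<Rightarrow> nat \<Rightarrow> nat" where
  "graph_code P = spike_code (set_code (Domain P)) (natfun_code (\<lambda>x. SOME k. (x, k) \<in> P))"

lemma graph_code:
  assumes "single_valued P" "(rval g, k) \<in> P"
  shows "graph_code P g n = rat_code 1 (Suc k)"
proof -
  have "(SOME k. (rval g, k) \<in> P) = k"
    using assms by (auto intro: some_equality dest: single_valuedD)
  with assms(2) show ?thesis
    by (auto simp: graph_code_def spike_code_def set_code_def natfun_code_def)
qed

text \<open>Inherited from \<open>kleene\<close>: for single-valued \<open>P\<close> both
  computations are computations relative to \<open>graph_code P\<close>.\<close>

lemma pkleene_deterministic:
  assumes "single_valued P" "pkleene H P e as r" "pkleene H P e as s"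
  shows "r = s"
proof -
  have "kleene e (map (obj_of H (graph_code P)) as) t" if "pkleene H P e as t" for t
    using that graph_code[OF assms(1)] by (rule pkleene_imp_kleene)
  then show ?thesis using assms(2,3) kleene_deterministic by blast
qed

lemma computes_deterministic:
  assumes "single_valued P" "computes args T H P c x" "computes args T H P c y"
  shows "x = y"
proof (cases c)
  case (Query d as)
  then obtain g h where "\<And>i. pkleene H P d (TNum i # TReal # as) (g i)" "x = rval g"
    "\<And>i. pkleene H P d (TNum i # TReal # as) (h i)" "y = rval h"
    using assms by auto
  moreover from this have "g = h" using pkleene_deterministic[OF assms(1)] by blast
  ultimately show ?thesis by simp
next
  case (Result e)
  then obtain g h where "\<And>i. pkleene H P e (args i) (g i)" "x = T g"
    "\<And>i. pkleene H P e (args i) (h i)" "y = T h"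
    using assms by auto
  moreover from this have "g = h" using pkleene_deterministic[OF assms(1)] by blast
  ultimately show ?thesis by simp
qed

text \<open>The circularity between the function and what is computable from it is resolved by
  maximality. Unions of chains stay admissible because \<open>computes\<close> is monotone in the
  map.\<close>

lemma ex_closed_graph:
  obtains P where "single_valued P" "\<And>x y k. (x, k) \<in> P \<Longrightarrow> (y, k) \<in> P \<Longrightarrow> x = y"
    "\<And>c x. computes args T H P c x \<Longrightarrow> x \<in> Domain P"
proof -
  \<comment> \<open>Every index must be justified by a computation that uses only \<open>P\<close>
    itself.\<close>
  define S where "S = {P. single_valued P \<and>
    (\<forall>(x, k)\<in>P. \<exists>c. k = to_nat c \<and> computes args T H P c x)}"
  have "\<exists>M\<in>S. \<forall>X\<in>S. M \<subseteq> X \<longrightarrow> X = M"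
  proof (rule Zorn_Lemma, intro ballI)
    fix C assume C: "C \<in> chains S"
    have sv: "single_valued (\<Union>C)"
    proof (rule single_valuedI)
      fix x k l assume "(x, k) \<in> \<Union>C" "(x, l) \<in> \<Union>C"
      then obtain P Q where "P \<in> C" "Q \<in> C" "(x, k) \<in> P" "(x, l) \<in> Q" by blast
      moreover from this have "P \<subseteq> Q \<or> Q \<subseteq> P" using C chainsD by blast
      moreover have "single_valued P" "single_valued Q"
        using C \<open>P \<in> C\<close> \<open>Q \<in> C\<close> chainsD2 by (auto simp: S_def)
      ultimately show "k = l" by (meson single_valuedD subsetD)
    qed
    have "\<exists>c. k = to_nat c \<and> computes args T H (\<Union>C) c x" if "(x, k) \<in> \<Union>C" for x k
    proof -
      obtain P where P: "P \<in> C" "(x, k) \<in> P" using \<open>(x, k) \<in> \<Union>C\<close> by blast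
      then have "P \<in> S" using C chainsD2 by blast
      with P(2) obtain c where "k = to_nat c" "computes args T H P c x" by (auto simp: S_def)
      moreover have "P \<subseteq> \<Union>C" using P(1) by blast
      ultimately show ?thesis using computes_mono by blast
    qed
    with sv show "\<Union>C \<in> S" by (auto simp: S_def)
  qed
  then obtain P where P: "P \<in> S" and max: "\<And>X. X \<in> S \<Longrightarrow> P \<subseteq> X \<Longrightarrow> X = P" by blast
  have sv: "single_valued P"
    and idx: "\<And>x k. (x, k) \<in> P \<Longrightarrow> \<exists>c. k = to_nat c \<and> computes args T H P c x"
    using P by (auto simp: S_def)
  show thesis
  proof
    show "single_valued P" by (rule sv)
    \<comment> \<open>The index \<open>k\<close> encodes a single configuration, which computes both
      \<open>x\<close> and \<open>y\<close> from \<open>P\<close>.\<close>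
    show "x = y" if "(x, k) \<in> P" "(y, k) \<in> P" for x y k
      using idx[OF that(1)] idx[OF that(2)] computes_deterministic[OF sv] by (metis from_nat_to_nat)
    show "x \<in> Domain P" if cx: "computes args T H P c x" for c x
    proof (rule ccontr)
      assume x: "x \<notin> Domain P"
      \<comment> \<open>A computable real without an index could be given the index of its own
        configuration, against maximality.\<close>
      define Q where "Q = insert (x, to_nat c) P"
      have "P \<subseteq> Q" by (auto simp: Q_def)
      have "single_valued Q" using sv x by (auto simp: Q_def single_valued_def)
      moreover have "\<exists>c. k = to_nat c \<and> computes args T H Q c y" if "(y, k) \<in> Q" for y k
        using that idx cx computes_mono[OF _ \<open>P \<subseteq> Q\<close>] unfolding Q_def by blast
      ultimately have "Q \<in> S" by (auto simp: S_def)
      then have "Q = P" using max \<open>P \<subseteq> Q\<close> by blast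
      then show False using x by (auto simp: Q_def)
    qed
  qed
qed

text \<open>Every real obtained from \<open>H\<close> and the spike function of \<open>A\<close>
  falls back into \<open>A\<close>. \<open>T\<close> is an arbitrary map on output sequences, so it
  can include a noneffective choice.\<close>

theorem diagonal_spike:
  fixes args :: "nat \<Rightarrow> tok list"
  obtains A :: "real set" and Y :: "real \<Rightarrow> nat" where "inj_on Y A"
    "\<And>e g. (\<And>i. kleene e (map (obj_of H (spike_code (set_code A) (natfun_code Y))) (args i)) (g i))
       \<Longrightarrow> T g \<in> A"
proof -
  obtain P where P: "single_valued P" "\<And>x y k. (x, k) \<in> P \<Longrightarrow> (y, k) \<in> P \<Longrightarrow> x = y"
    "\<And>c x. computes args T H P c x \<Longrightarrow> x \<in> Domain P"
    by (rule ex_closed_graph[of args T H]) blast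
  show thesis
  proof
    show "inj_on (\<lambda>x. SOME k. (x, k) \<in> P) (Domain P)"
      by (rule inj_onI) (metis DomainE P(2) someI)
    fix e g
    assume "\<And>i. kleene e (map (obj_of H (spike_code (set_code (Domain P))
      (natfun_code (\<lambda>x. SOME k. (x, k) \<in> P)))) (args i)) (g i)"
    then have kl: "kleene e (map (obj_of H (graph_code P)) (args i)) (g i)" for i
      by (simp add: graph_code_def)
    have closed: "\<exists>k. (rval g, k) \<in> P"
      if "\<And>x. pkleene H P d (TNum x # TReal # as) (g x)" for d as g
      using P(3)[of "Query d as" "rval g"] that by auto
    have "pkleene H P e (args i) (g i)" for i
    proof -
      from kl have "\<forall>as. map (obj_of H (graph_code P)) (args i) = map (obj_of H (graph_code P)) as
          \<longrightarrow> pkleene H P e as (g i)"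
        by (rule kleene_imp_pkleene) (use graph_code[OF P(1)] closed in blast)+
      then show ?thesis by blast
    qed
    then show "T g \<in> Domain P" by (intro P(3)[of "Result e"]) auto
  qed
qed

section \<open>Noncomputability of (a), (b) and (c) in an arbitrary type-2 functional\<close>

lemma cont_point_not_computable:
  assumes "cont_point_functional \<Phi>"
  shows "\<not> computable_R [Fun2 H] \<Phi>"
proof
  assume "computable_R [Fun2 H] \<Phi>"
  then obtain e where e: "\<And>F f n. codes_fun F f \<Longrightarrow> kleene e [Fun2 H, RFun F, Num n] (\<Phi> F n)"
    by (auto simp: computable_R_def)
  obtain A Y where Y: "inj_on Y A"
    and A: "\<And>e g. (\<And>i. kleene e (map (obj_of H (spike_code (set_code A) (natfun_code Y)))
      [TFun, TReal, TNum i]) (g i)) \<Longrightarrow> rval g \<in> A"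
    by (rule diagonal_spike[of H "\<lambda>i. [TFun, TReal, TNum i]" rval]) blast
  let ?F = "spike_code (set_code A) (natfun_code Y)"
  have "rval (\<Phi> ?F) \<in> A" by (rule A[of e]) (use e[OF codes_fun_spike] in simp)
  moreover have "rval (\<Phi> ?F) \<in> cont_points (spike A Y)"
    using assms codes_fun_spike cliquish_spike[OF Y] by (auto simp: cont_point_functional_def)
  ultimately show False by (simp add: cont_points_spike[OF Y])
qed

lemma SUP_spike_upper:
  "x \<in> {p..q} \<Longrightarrow> spike A Y x \<le> (SUP x\<in>{p..q}. spike A Y x)"
  by (rule cSUP_upper) (auto intro: bdd_aboveI2[where M = 1] spike_bounds)

text \<open>The suprema over all rational intervals form one computable sequence, and this sequence
  determines a zero of the spike function, that is, a point outside \<open>A\<close>. The choice of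
  the zero is left to \<open>T\<close>.\<close>

lemma sup_not_computable:
  assumes "sup_functional \<Psi>"
  shows "\<not> computable_RR [Fun2 H] \<Psi>"
proof
  assume "computable_RR [Fun2 H] \<Psi>"
  then obtain e where e: "\<And>F f \<alpha> \<beta> n. codes_fun F f \<Longrightarrow>
      kleene e [Fun2 H, RFun F, Seq \<alpha>, Seq \<beta>, Num n] (\<Psi> F \<alpha> \<beta> n)"
    unfolding computable_RR_def append_Cons append_Nil by blast
  define q where "q i = rval (\<lambda>_. i)" for i
  \<comment> \<open>The number \<open>m\<close> encodes both rational endpoints and the position
    \<open>n\<close> in the code of the supremum, so that one sequence holds all suprema.\<close>
  define args where "args m = (case prod_decode m of (i, m') \<Rightarrow> case prod_decode m' of (j, n) \<Rightarrow>
    [TFun, TReal, TConst i, TConst j, TNum n])" for m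
  define sup where "sup g i j = rval (\<lambda>n. g (prod_encode (i, prod_encode (j, n))))"
    for g :: "nat \<Rightarrow> nat" and i j
  \<comment> \<open>Being a zero is expressed through \<open>g\<close> alone: rational intervals
    around \<open>x\<close> have arbitrarily small suprema.\<close>
  define null where "null g x \<longleftrightarrow> x \<in> {0..1} \<and>
    (\<forall>\<epsilon>>0. \<exists>i j. 0 \<le> q i \<and> q i \<le> x \<and> x \<le> q j \<and> q j \<le> 1 \<and> sup g i j \<le> \<epsilon>)" for g x
  obtain A Y where Y: "inj_on Y A"
    and A: "\<And>e g. (\<And>m. kleene e (map (obj_of H (spike_code (set_code A) (natfun_code Y)))
      (args m)) (g m)) \<Longrightarrow> (SOME x. null g x) \<in> A"
    by (rule diagonal_spike[of H args "\<lambda>g. SOME x. null g x"]) blast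
  let ?F = "spike_code (set_code A) (natfun_code Y)"
  define g where "g m = (case prod_decode m of (i, m') \<Rightarrow> case prod_decode m' of (j, n) \<Rightarrow>
    \<Psi> ?F (\<lambda>_. i) (\<lambda>_. j) n)" for m
  have "(SOME x. null g x) \<in> A"
    by (rule A[of e]) (use e[OF codes_fun_spike] in \<open>simp add: args_def g_def split: prod.split\<close>)
  have sup: "sup g i j = (SUP x\<in>{q i..q j}. spike A Y x)"
    if "0 \<le> q i" "q i \<le> q j" "q j \<le> 1" for i j
    using assms codes_fun_spike cliquish_spike[OF Y] that
    unfolding sup_functional_def sup_def g_def q_def by simp
  obtain x where x: "x \<in> {0<..<1}" "x \<notin> A" using ex_notin_interval[OF Y, of 0 1] by auto
  have "null g x"
    unfolding null_def
  proof (intro conjI allI impI)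
    fix \<epsilon> :: real assume "\<epsilon> > 0"
    then obtain d where d: "d > 0" "\<And>y. \<bar>y - x\<bar> < d \<Longrightarrow> spike A Y y < \<epsilon>"
      using spike_small_near[OF Y x(2)] by metis
    have q: "\<exists>i. a < q i \<and> q i < b" if ab: "a < b" for a b
    proof -
      obtain r where "a < of_rat r" "of_rat r < b" using of_rat_dense[OF ab] by blast
      moreover obtain i where "r = nat_to_rat_surj i" using surjD[OF surj_nat_to_rat_surj] by blast
      ultimately show ?thesis by (auto simp: q_def rval_const)
    qed
    obtain i where i: "max 0 (x - d) < q i" "q i < x" using q[of "max 0 (x - d)" x] x d(1) by auto
    obtain j where j: "x < q j" "q j < min 1 (x + d)" using q[of x "min 1 (x + d)"] x d(1) by auto
    have "(SUP x\<in>{q i..q j}. spike A Y x) \<le> \<epsilon>"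
      by (rule cSUP_least) (use i j in \<open>auto intro!: less_imp_le d(2)\<close>)
    then show "\<exists>i j. 0 \<le> q i \<and> q i \<le> x \<and> x \<le> q j \<and> q j \<le> 1 \<and> sup g i j \<le> \<epsilon>"
      using i j sup[of i j] by (intro exI[of _ i] exI[of _ j]) auto
  qed (use x in auto)
  then have "null g (SOME x. null g x)" by (rule someI)
  moreover have "\<not> null g x" if "x \<in> A" for x
  proof
    assume "null g x"
    \<comment> \<open>Half of the value at \<open>x\<close> is a bound that no supremum over an
      interval containing \<open>x\<close> can meet.\<close>
    moreover have "spike A Y x / 2 > 0" using that spike_pos_iff[of A Y x] by simp
    ultimately obtain i j where ij: "0 \<le> q i" "q i \<le> x" "x \<le> q j" "q j \<le> 1"
      "sup g i j \<le> spike A Y x / 2" unfolding null_def by blast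
    then have "sup g i j = (SUP x\<in>{q i..q j}. spike A Y x)" by (intro sup) auto
    moreover have "spike A Y x \<le> (SUP x\<in>{q i..q j}. spike A Y x)"
      by (rule SUP_spike_upper) (use ij in auto)
    ultimately show False using ij(5) \<open>spike A Y x / 2 > 0\<close> by linarith
  qed
  ultimately show False using \<open>(SOME x. null g x) \<in> A\<close> by blast
qed

lemma Gdelta_not_computable:
  assumes "Gdelta_functional \<zeta>"
  shows "\<not> computable_NN [Fun2 H] \<zeta>"
proof
  assume "computable_NN [Fun2 H] \<zeta>"
  then obtain e where e: "\<And>F f m n. codes_fun F f \<Longrightarrow>
      kleene e [Fun2 H, RFun F, Num m, Num n] (\<zeta> F m n)"
    by (auto simp: computable_NN_def)
  define args where "args i = (case prod_decode i of (m, n) \<Rightarrow> [TFun, TReal, TNum m, TNum n])" for i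
  \<comment> \<open>The sequence of interval codes determines the set of continuity points, from
    which \<open>T\<close> picks one.\<close>
  define T where "T g = (SOME x. x \<in> (\<Inter>n. \<Union>m. rat_interval (g (prod_encode (m, n)))))"
    for g :: "nat \<Rightarrow> nat"
  obtain A Y where Y: "inj_on Y A"
    and A: "\<And>e g. (\<And>i. kleene e (map (obj_of H (spike_code (set_code A) (natfun_code Y)))
      (args i)) (g i)) \<Longrightarrow> T g \<in> A"
    by (rule diagonal_spike[of H args T]) blast
  let ?F = "spike_code (set_code A) (natfun_code Y)"
  define g where "g i = (case prod_decode i of (m, n) \<Rightarrow> \<zeta> ?F m n)" for i
  have "T g \<in> A"
    by (rule A[of e]) (use e[OF codes_fun_spike] in \<open>simp add: args_def g_def split: prod.split\<close>)
  have "cont_points (spike A Y) = (\<Inter>n. \<Union>m. rat_interval (\<zeta> ?F m n))"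
    using assms codes_fun_spike cliquish_spike[OF Y] unfolding Gdelta_functional_def by blast
  then have eq: "{0..1} - A = (\<Inter>n. \<Union>m. rat_interval (g (prod_encode (m, n))))"
    by (simp add: cont_points_spike[OF Y] g_def)
  moreover obtain x where "x \<in> {0<..<1}" "x \<notin> A" using ex_notin_interval[OF Y, of 0 1] by auto
  ultimately have "x \<in> (\<Inter>n. \<Union>m. rat_interval (g (prod_encode (m, n))))"
    by (metis DiffI greaterThanLessThan_subseteq_atLeastAtMost_iff order_refl subsetD)
  then have "T g \<in> {0..1} - A" unfolding T_def eq by (rule someI)
  with \<open>T g \<in> A\<close> show False by simp
qed

section \<open>Closure properties of Kleene computability\<close>

text \<open>The permutation in S6 is part of the index and depends on the number of arguments, so a
  uniform index needs a constant length.\<close>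

definition fixed_length :: "('q \<Rightarrow> obj list) \<Rightarrow> bool" where
  "fixed_length os \<longleftrightarrow> (\<exists>L. \<forall>q. length (os q) = L)"

lemma fixed_length_Nil: "fixed_length (\<lambda>q. [])"
  by (simp add: fixed_length_def)

lemma fixed_length_Cons: "fixed_length os \<Longrightarrow> fixed_length (\<lambda>q. x q # os q)"
  by (auto simp: fixed_length_def)

lemma fixed_length_comp: "fixed_length os \<Longrightarrow> fixed_length (\<lambda>q. os (f q))"
  by (auto simp: fixed_length_def)

text \<open>The parameter \<open>q\<close> ranges over the values of all arguments, in which \<open>e\<close> has to be uniform.\<close>

definition kcomp :: "('q \<Rightarrow> obj list) \<Rightarrow> ('q \<Rightarrow> nat) \<Rightarrow> bool" where
  "kcomp os \<phi> \<longleftrightarrow> fixed_length os \<and> (\<exists>e. \<forall>q. kleene e (os q) (\<phi> q))"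

definition position :: "('q \<Rightarrow> obj list) \<Rightarrow> nat \<Rightarrow> ('q \<Rightarrow> obj) \<Rightarrow> bool" where
  "position os i x \<longleftrightarrow> (\<forall>q. i < length (os q) \<and> os q ! i = x q)"

definition occurs :: "('q \<Rightarrow> obj list) \<Rightarrow> ('q \<Rightarrow> obj) \<Rightarrow> bool" where
  "occurs os x \<longleftrightarrow> (\<exists>i. position os i x)"

lemma occurs_0: "occurs (\<lambda>q. x q # os q) x"
  unfolding occurs_def position_def by (rule exI[of _ 0]) simp

lemma occurs_Suc: "occurs os x \<Longrightarrow> occurs (\<lambda>q. y q # os q) x"
  unfolding occurs_def position_def by (metis Suc_less_eq length_Cons nth_Cons_Suc)

lemma kcompI: "fixed_length os \<Longrightarrow> (\<And>q. kleene e (os q) (\<phi> q)) \<Longrightarrow> kcomp os \<phi>"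
  by (auto simp: kcomp_def)

lemma kcomp_cong: "kcomp os \<phi> \<Longrightarrow> (\<And>q. \<phi> q = \<psi> q) \<Longrightarrow> kcomp os \<psi>"
  by (simp add: kcomp_def)

lemma kcomp_const: "fixed_length os \<Longrightarrow> kcomp os (\<lambda>q. c)"
  by (rule kcompI) (auto intro: kleene.S2)

lemma kcomp_subst: "kcomp os \<phi> \<Longrightarrow> kcomp (\<lambda>q. os (f q)) (\<lambda>q. \<phi> (f q))"
  by (auto simp: kcomp_def intro: fixed_length_comp)

lemma kcomp_let:
  assumes "kcomp os \<phi>" "kcomp (\<lambda>q. Num (\<phi> q) # os q) \<psi>"
  shows "kcomp os \<psi>"
proof -
  obtain d c where "\<And>q. kleene d (os q) (\<phi> q)" "\<And>q. kleene c (Num (\<phi> q) # os q) (\<psi> q)"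
    using assms by (auto simp: kcomp_def)
  then have "kleene (list_encode [4, c, d]) (os q) (\<psi> q)" for q by (rule kleene.S4)
  then show ?thesis using assms(1) by (auto simp: kcomp_def)
qed

text \<open>S6 moves the selected arguments to the front and S9 drops the others.\<close>

lemma kcomp_select:
  assumes "kcomp (\<lambda>q. map ((!) (os q)) js) \<phi>" "distinct js"
    and "\<And>q. set js \<subseteq> {..<length (os q)}" "fixed_length os"
  shows "kcomp os \<phi>"
proof -
  obtain e where e: "\<And>q. kleene e (map ((!) (os q)) js) (\<phi> q)"
    using assms(1) by (auto simp: kcomp_def)
  obtain L where L: "\<And>q. length (os q) = L" using assms(4) by (auto simp: fixed_length_def)
  define p where "p = js @ filter (\<lambda>i. i \<notin> set js) [0..<L]"
  define d where "d = list_encode [4, list_encode [9, length js], list_encode [2, e]]"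
  have p: "distinct p" "set p = {..<L}" using assms(2,3) L by (auto simp: p_def)
  have "kleene (list_encode [6, d, list_encode p]) (os q) (\<phi> q)" for q
  proof (rule kleene.S6)
    have "kleene (list_encode [9, length js]) (Num e # map ((!) (os q)) p) (\<phi> q)"
      by (rule kleene.S9) (simp_all add: p_def e)
    with kleene.S2 show "kleene d (map (\<lambda>i. os q ! i) p) (\<phi> q)"
      unfolding d_def by (rule kleene.S4)
  qed (simp_all add: p L)
  then show ?thesis using assms(4) by (auto simp: kcomp_def)
qed

lemma kcomp_weaken:
  assumes "kcomp os \<phi>"
  shows "kcomp (\<lambda>q. x q # os q) \<phi>"
proof -
  have fl: "fixed_length os" using assms by (simp add: kcomp_def)
  then obtain L where L: "\<And>q. length (os q) = L" by (auto simp: fixed_length_def)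
  have eq: "map ((!) (x q # os q)) (map Suc [0..<L]) = os q" for q
    by (rule nth_equalityI) (simp_all add: L)
  show ?thesis
  proof (rule kcomp_select)
    show "kcomp (\<lambda>q. map ((!) (x q # os q)) (map Suc [0..<L])) \<phi>" unfolding eq by (rule assms)
  qed (auto simp: L distinct_map intro: fixed_length_Cons fl)
qed

section \<open>Moving an argument to the front and back\<close>

definition remove_at :: "nat \<Rightarrow> 'a list \<Rightarrow> 'a list" where
  "remove_at i xs = take i xs @ drop (Suc i) xs"

lemma nth_remove_at: "i < length xs \<Longrightarrow> j < length xs - 1 \<Longrightarrow> remove_at i xs ! j = xs ! (if j < i then j else Suc j)"
  by (auto simp: remove_at_def nth_append)

lemma length_remove_at: "i < length xs \<Longrightarrow> length (remove_at i xs) = length xs - 1"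
  by (simp add: remove_at_def)

lemma fixed_length_remove_at:
  assumes "fixed_length os" "position os i x"
  shows "fixed_length (\<lambda>q. remove_at i (os q))"
proof -
  obtain L where "\<And>q. length (os q) = L" using assms(1) by (auto simp: fixed_length_def)
  then have "length (remove_at i (os q)) = L - 1" for q
    using assms(2) by (simp add: position_def length_remove_at)
  then show ?thesis by (auto simp: fixed_length_def)
qed

text \<open>S3, S7 and S8 look for their operands at the head of the list; this allows an argument
  in any position to play that role.\<close>

lemma kcomp_front:
  assumes x: "position os i x" and fl: "fixed_length os"
    and k: "kcomp (\<lambda>q. x q # remove_at i (os q)) \<phi>"
  shows "kcomp os \<phi>"
proof -
  obtain L where L: "\<And>q. length (os q) = L" using fl by (auto simp: fixed_length_def)
  have i: "i < L" "\<And>q. os q ! i = x q" using x L by (auto simp: position_def)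
  define js where "js = i # map (\<lambda>j. if j < i then j else Suc j) [0..<L - 1]"
  have eq: "map ((!) (os q)) js = x q # remove_at i (os q)" for q
  proof (rule nth_equalityI)
    show "length (map ((!) (os q)) js) = length (x q # remove_at i (os q))"
      using i(1) by (simp add: js_def L length_remove_at)
    fix j assume "j < length (map ((!) (os q)) js)"
    then have "j < Suc (L - 1)" by (simp add: js_def)
    then show "map ((!) (os q)) js ! j = (x q # remove_at i (os q)) ! j"
      using i by (cases j) (simp_all add: js_def L nth_remove_at)
  qed
  show ?thesis
  proof (rule kcomp_select)
    show "kcomp (\<lambda>q. map ((!) (os q)) js) \<phi>" unfolding eq by (rule k)
    show "distinct js" by (auto simp: js_def distinct_map inj_on_def)
    show "set js \<subseteq> {..<length (os q)}" for q using i(1) by (auto simp: js_def L)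
  qed (rule fl)
qed

text \<open>The inverse move, needed for the inner computations of S8: they receive the bound
  arguments \<open>us\<close>, then the applied functional, then the others. The map
  \<open>f\<close> recovers the outer parameter from the extended one.\<close>

lemma kcomp_back:
  assumes x: "position os i x" and fl: "fixed_length os" and us: "fixed_length us"
    and k: "kcomp (\<lambda>r. us r @ os (f r)) \<phi>"
  shows "kcomp (\<lambda>r. us r @ x (f r) # remove_at i (os (f r))) \<phi>"
proof -
  obtain L where L: "\<And>q. length (os q) = L" using fl by (auto simp: fixed_length_def)
  obtain M where M: "\<And>r. length (us r) = M" using us by (auto simp: fixed_length_def)
  have i: "i < L" "\<And>q. os q ! i = x q" using x L by (auto simp: position_def)
  define js where
    "js = [0..<M] @ map (\<lambda>j. M + (if j < i then Suc j else if j = i then 0 else j)) [0..<L]"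
  have nth: "(x q # remove_at i (os q)) ! (if j < i then Suc j else if j = i then 0 else j) = os q ! j"
    if "j < L" for q j
    using that i by (cases j) (auto simp: nth_remove_at L)
  have eq: "map ((!) (us r @ x (f r) # remove_at i (os (f r)))) js = us r @ os (f r)" for r
  proof (rule nth_equalityI)
    show "length (map ((!) (us r @ x (f r) # remove_at i (os (f r)))) js) = length (us r @ os (f r))"
      by (simp add: js_def M L)
    fix k assume "k < length (map ((!) (us r @ x (f r) # remove_at i (os (f r)))) js)"
    then have k: "k < M + L" by (simp add: js_def)
    show "map ((!) (us r @ x (f r) # remove_at i (os (f r)))) js ! k = (us r @ os (f r)) ! k"
    proof (cases "k < M")
      case True
      then show ?thesis using k by (simp add: js_def nth_append M)
    next
      case False
      define j where "j = k - M"
      have j: "k = M + j" "j < L" using False k by (auto simp: j_def)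
      have "map ((!) (us r @ x (f r) # remove_at i (os (f r)))) js ! k
          = (us r @ x (f r) # remove_at i (os (f r))) ! (js ! k)"
        by (rule nth_map) (use k in \<open>simp add: js_def\<close>)
      also have "js ! k = M + (if j < i then Suc j else if j = i then 0 else j)"
        using j by (simp only: js_def) (simp add: nth_append)
      also have "(us r @ x (f r) # remove_at i (os (f r))) ! \<dots> = os (f r) ! j"
        using nth[OF j(2), of "f r"] by (simp only: nth_append M) simp
      also have "\<dots> = (us r @ os (f r)) ! k" using j(1) by (simp add: nth_append M)
      finally show ?thesis .
    qed
  qed
  show ?thesis
  proof (rule kcomp_select)
    show "kcomp (\<lambda>r. map ((!) (us r @ x (f r) # remove_at i (os (f r)))) js) \<phi>" unfolding eq by (rule k)
    show "distinct js" unfolding js_def distinct_append distinct_map by (auto simp: inj_on_def)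
    show "set js \<subseteq> {..<length (us r @ x (f r) # remove_at i (os (f r)))}" for r
      using i(1) by (auto simp: js_def M L length_remove_at)
    show "fixed_length (\<lambda>r. us r @ x (f r) # remove_at i (os (f r)))"
      using i(1) by (auto simp: fixed_length_def M L length_remove_at)
  qed
qed

section \<open>Variables, primitive recursion and application of functionals\<close>

lemma kcomp_var:
  assumes "occurs os (\<lambda>q. Num (v q))" and fl: "fixed_length os"
  shows "kcomp os v"
proof -
  obtain i where i: "position os i (\<lambda>q. Num (v q))" using assms(1) by (auto simp: occurs_def)
  show ?thesis
    by (rule kcomp_front[OF i fl], rule kcompI)
      (auto intro: kleene.S3 fixed_length_Cons fixed_length_remove_at[OF fl i])
qed

lemma kcomp_fixed_length: "kcomp os \<phi> \<Longrightarrow> fixed_length os"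
  by (simp add: kcomp_def)

lemma kcomp_var_0: "fixed_length os \<Longrightarrow> kcomp (\<lambda>q. Num (v q) # os q) v"
  by (intro kcomp_var occurs_0 fixed_length_Cons)

lemma kcomp_Suc:
  assumes "kcomp os \<phi>"
  shows "kcomp os (\<lambda>q. Suc (\<phi> q))"
  by (rule kcomp_let[OF assms], rule kcompI)
    (auto intro: kleene.S1 fixed_length_Cons kcomp_fixed_length[OF assms])

lemma kcomp_rec_nat:
  assumes "kcomp os \<phi>" "kcomp os \<tau>"
    and "kcomp (\<lambda>z. Num (fst z) # Num (fst (snd z)) # os (snd (snd z)))
      (\<lambda>z. \<psi> (fst z) (fst (snd z)) (snd (snd z)))"
  shows "kcomp os (\<lambda>q. rec_nat (\<phi> q) (\<lambda>a s. \<psi> a s q) (\<tau> q))"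
proof (rule kcomp_let[OF assms(2)])
  obtain c where c: "\<And>q. kleene c (os q) (\<phi> q)" using assms(1) by (auto simp: kcomp_def)
  obtain d where d: "\<And>a s q. kleene d (Num a # Num s # os q) (\<psi> a s q)"
    using assms(3) by (auto simp: kcomp_def)
  have "kleene (list_encode [5, c, d]) (Num n # os q) (rec_nat (\<phi> q) (\<lambda>a s. \<psi> a s q) n)" for n q
    by (induction n) (auto intro: kleene.S5_0 kleene.S5_Suc c d)
  then show "kcomp (\<lambda>q. Num (\<tau> q) # os q) (\<lambda>q. rec_nat (\<phi> q) (\<lambda>a s. \<psi> a s q) (\<tau> q))"
    by (intro kcompI fixed_length_Cons kcomp_fixed_length[OF assms(1)])
qed

lemma kcomp_back_0:
  assumes "position os i x" "kcomp os \<phi>"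
  shows "kcomp (\<lambda>q. x q # remove_at i (os q)) \<phi>"
  using kcomp_back[OF assms(1) kcomp_fixed_length[OF assms(2)] fixed_length_Nil, of "\<lambda>q. q" \<phi>] assms(2)
  by simp

lemma kcomp_back_1:
  assumes "position os i x" "fixed_length os" "kcomp (\<lambda>r. u r # os (f r)) \<phi>"
  shows "kcomp (\<lambda>r. u r # x (f r) # remove_at i (os (f r))) \<phi>"
  using kcomp_back[OF assms(1,2), of "\<lambda>r. [u r]" f \<phi>] assms(3) by (simp add: fixed_length_def)

lemma kcomp_back_2:
  assumes "position os i x" "fixed_length os" "kcomp (\<lambda>r. u r # v r # os (f r)) \<phi>"
  shows "kcomp (\<lambda>r. u r # v r # x (f r) # remove_at i (os (f r))) \<phi>"
  using kcomp_back[OF assms(1,2), of "\<lambda>r. [u r, v r]" f \<phi>] assms(3) by (simp add: fixed_length_def)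

lemma kcomp_Seq:
  assumes h: "occurs os (\<lambda>q. Seq (h q))" and \<tau>: "kcomp os \<tau>"
  shows "kcomp os (\<lambda>q. h q (\<tau> q))"
proof -
  have fl: "fixed_length os" by (rule kcomp_fixed_length[OF \<tau>])
  obtain i where i: "position os i (\<lambda>q. Seq (h q))" using h by (auto simp: occurs_def)
  show ?thesis
  proof (rule kcomp_front[OF i fl], rule kcomp_let)
    show "kcomp (\<lambda>q. Seq (h q) # remove_at i (os q)) \<tau>" by (rule kcomp_back_0[OF i \<tau>])
    show "kcomp (\<lambda>q. Num (\<tau> q) # Seq (h q) # remove_at i (os q)) (\<lambda>q. h q (\<tau> q))"
      by (rule kcompI, intro fixed_length_Cons fixed_length_remove_at[OF fl i]) (rule kleene.S7)
  qed
qed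

text \<open>The pair \<open>z\<close> consists of the bound number and the outer parameter, so one
  index for the inner function is uniform in both, as S8 requires.\<close>

lemma kcomp_Fun2:
  assumes H: "occurs os (\<lambda>q. Fun2 (H q))" and fl: "fixed_length os"
    and \<psi>: "kcomp (\<lambda>z. Num (fst z) # os (snd z)) (\<lambda>z. \<psi> (fst z) (snd z))"
  shows "kcomp os (\<lambda>q. H q (\<lambda>x. \<psi> x q))"
proof -
  obtain i where i: "position os i (\<lambda>q. Fun2 (H q))" using H by (auto simp: occurs_def)
  obtain d where d: "\<And>x q. kleene d (Num x # Fun2 (H q) # remove_at i (os q)) (\<psi> x q)"
    using kcomp_back_1[OF i fl \<psi>] by (auto simp: kcomp_def)
  show ?thesis
    by (rule kcomp_front[OF i fl], rule kcompI)
      (rule fixed_length_Cons fixed_length_remove_at[OF fl i] kleene.S8_Fun2 d)+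
qed

lemma kcomp_OpR:
  assumes \<Phi>: "occurs os (\<lambda>q. OpR \<Phi>)"
    and G: "kcomp (\<lambda>z. Seq (fst z) # Num (fst (snd z)) # os (snd (snd z)))
      (\<lambda>z. G (snd (snd z)) (fst z) (fst (snd z)))"
    and n: "kcomp os n"
  shows "kcomp os (\<lambda>q. \<Phi> (G q) (n q))"
proof -
  have fl: "fixed_length os" by (rule kcomp_fixed_length[OF n])
  obtain i where i: "position os i (\<lambda>q. OpR \<Phi>)" using \<Phi> by (auto simp: occurs_def)
  obtain d where d: "\<And>h x q. kleene d (Seq h # Num x # OpR \<Phi> # remove_at i (os q)) (G q h x)"
    using kcomp_back_2[OF i fl G] by (auto simp: kcomp_def)
  obtain c where c: "\<And>q. kleene c (OpR \<Phi> # remove_at i (os q)) (n q)"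
    using kcomp_back_0[OF i n] by (auto simp: kcomp_def)
  show ?thesis
    by (rule kcomp_front[OF i fl], rule kcompI)
      (rule fixed_length_Cons fixed_length_remove_at[OF fl i] kleene.S8_OpR d c)+
qed

lemma kcomp_OpRR:
  assumes \<Psi>: "occurs os (\<lambda>q. OpRR \<Psi>)"
    and G: "kcomp (\<lambda>z. Seq (fst z) # Num (fst (snd z)) # os (snd (snd z)))
      (\<lambda>z. G (snd (snd z)) (fst z) (fst (snd z)))"
    and u: "kcomp (\<lambda>z. Num (fst z) # os (snd z)) (\<lambda>z. u (snd z) (fst z))"
    and v: "kcomp (\<lambda>z. Num (fst z) # os (snd z)) (\<lambda>z. v (snd z) (fst z))"
    and n: "kcomp os n"
  shows "kcomp os (\<lambda>q. \<Psi> (G q) (u q) (v q) (n q))"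
proof -
  have fl: "fixed_length os" by (rule kcomp_fixed_length[OF n])
  obtain i where i: "position os i (\<lambda>q. OpRR \<Psi>)" using \<Psi> by (auto simp: occurs_def)
  obtain d where d: "\<And>h x q. kleene d (Seq h # Num x # OpRR \<Psi> # remove_at i (os q)) (G q h x)"
    using kcomp_back_2[OF i fl G] by (auto simp: kcomp_def)
  obtain a where a: "\<And>x q. kleene a (Num x # OpRR \<Psi> # remove_at i (os q)) (u q x)"
    using kcomp_back_1[OF i fl u] by (auto simp: kcomp_def)
  obtain b where b: "\<And>x q. kleene b (Num x # OpRR \<Psi> # remove_at i (os q)) (v q x)"
    using kcomp_back_1[OF i fl v] by (auto simp: kcomp_def)
  obtain c where c: "\<And>q. kleene c (OpRR \<Psi> # remove_at i (os q)) (n q)"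
    using kcomp_back_0[OF i n] by (auto simp: kcomp_def)
  show ?thesis
    by (rule kcomp_front[OF i fl], rule kcompI)
      (rule fixed_length_Cons fixed_length_remove_at[OF fl i] kleene.S8_OpRR d a b c)+
qed

lemma kcomp_OpNN:
  assumes \<zeta>: "occurs os (\<lambda>q. OpNN \<zeta>)"
    and G: "kcomp (\<lambda>z. Seq (fst z) # Num (fst (snd z)) # os (snd (snd z)))
      (\<lambda>z. G (snd (snd z)) (fst z) (fst (snd z)))"
    and m: "kcomp os m" and n: "kcomp os n"
  shows "kcomp os (\<lambda>q. \<zeta> (G q) (m q) (n q))"
proof -
  have fl: "fixed_length os" by (rule kcomp_fixed_length[OF n])
  obtain i where i: "position os i (\<lambda>q. OpNN \<zeta>)" using \<zeta> by (auto simp: occurs_def)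
  obtain d where d: "\<And>h x q. kleene d (Seq h # Num x # OpNN \<zeta> # remove_at i (os q)) (G q h x)"
    using kcomp_back_2[OF i fl G] by (auto simp: kcomp_def)
  obtain b where b: "\<And>q. kleene b (OpNN \<zeta> # remove_at i (os q)) (m q)"
    using kcomp_back_0[OF i m] by (auto simp: kcomp_def)
  obtain c where c: "\<And>q. kleene c (OpNN \<zeta> # remove_at i (os q)) (n q)"
    using kcomp_back_0[OF i n] by (auto simp: kcomp_def)
  show ?thesis
    by (rule kcomp_front[OF i fl], rule kcompI)
      (rule fixed_length_Cons fixed_length_remove_at[OF fl i] kleene.S8_OpNN d b c)+
qed

lemma kcomp_bind:
  assumes "kcomp os \<phi>"
  shows "kcomp (\<lambda>z. u z # os (snd z)) (\<lambda>z. \<phi> (snd z))"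
  using kcomp_subst[OF assms, of snd] by (rule kcomp_weaken)

lemma kcomp_bind2:
  assumes "kcomp os \<phi>"
  shows "kcomp (\<lambda>z. u z # v z # os (snd (snd z))) (\<lambda>z. \<phi> (snd (snd z)))"
  using kcomp_subst[OF assms, of "\<lambda>z. snd (snd z)"] by (intro kcomp_weaken)

lemma occurs_comp: "occurs os x \<Longrightarrow> occurs (\<lambda>q. os (f q)) (\<lambda>q. x (f q))"
  by (auto simp: occurs_def position_def)

lemma occurs_bind:
  assumes "occurs os x"
  shows "occurs (\<lambda>z. u z # os (snd z)) (\<lambda>z. x (snd z))"
  using occurs_comp[OF assms, of snd] by (rule occurs_Suc)

lemma occurs_bind2:
  assumes "occurs os x"
  shows "occurs (\<lambda>z. u z # v z # os (snd (snd z))) (\<lambda>z. x (snd (snd z)))"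
  using occurs_comp[OF assms, of "\<lambda>z. snd (snd z)"] by (intro occurs_Suc)

lemma fixed_length_bind:
  assumes "fixed_length os"
  shows "fixed_length (\<lambda>z. u z # os (snd z))"
  using fixed_length_comp[OF assms, of snd] by (rule fixed_length_Cons)

lemma fixed_length_bind2:
  assumes "fixed_length os"
  shows "fixed_length (\<lambda>z. u z # v z # os (snd (snd z)))"
  using fixed_length_comp[OF assms, of "\<lambda>z. snd (snd z)"] by (intro fixed_length_Cons)

lemma kcomp_bind_var: "fixed_length os \<Longrightarrow> kcomp (\<lambda>z. Num (fst z) # os (snd z)) (\<lambda>z. fst z)"
  using kcomp_var_0[OF fixed_length_comp[of os snd]] .

lemma kcomp_bind2_var:
  assumes "fixed_length os"
  shows "kcomp (\<lambda>z. Num (fst z) # Num (fst (snd z)) # os (snd (snd z))) (\<lambda>z. fst z)"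
    and "kcomp (\<lambda>z. Num (fst z) # Num (fst (snd z)) # os (snd (snd z))) (\<lambda>z. fst (snd z))"
proof -
  have fl: "fixed_length (\<lambda>z. os (snd (snd z)))"
    using assms by (rule fixed_length_comp[where f = "\<lambda>z. snd (snd z)"])
  show "kcomp (\<lambda>z. Num (fst z) # Num (fst (snd z)) # os (snd (snd z))) (\<lambda>z. fst z)"
    by (rule kcomp_var_0, rule fixed_length_Cons, rule fl)
  show "kcomp (\<lambda>z. Num (fst z) # Num (fst (snd z)) # os (snd (snd z))) (\<lambda>z. fst (snd z))"
    by (rule kcomp_weaken, rule kcomp_var_0, rule fl)
qed

section \<open>Arithmetic and decidable relations\<close>

lemma kcomp_add:
  assumes "kcomp os \<phi>" "kcomp os \<psi>"
  shows "kcomp os (\<lambda>q. \<phi> q + \<psi> q)"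
proof -
  have "kcomp os (\<lambda>q. rec_nat (\<psi> q) (\<lambda>a s. Suc s) (\<phi> q))"
    by (rule kcomp_rec_nat[OF assms(2,1)], rule kcomp_Suc)
      (rule kcomp_bind2_var[OF kcomp_fixed_length[OF assms(1)]])
  moreover have "rec_nat m (\<lambda>a s. Suc s) n = n + m" for m n by (induction n) auto
  ultimately show ?thesis by simp
qed

lemma kcomp_mult:
  assumes "kcomp os \<phi>" "kcomp os \<psi>"
  shows "kcomp os (\<lambda>q. \<phi> q * \<psi> q)"
proof -
  note fl = kcomp_fixed_length[OF assms(1)]
  have "kcomp os (\<lambda>q. rec_nat 0 (\<lambda>a s. s + \<psi> q) (\<phi> q))"
    by (rule kcomp_rec_nat[OF kcomp_const[OF fl] assms(1)], rule kcomp_add)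
      (rule kcomp_bind2_var[OF fl] kcomp_bind2[OF assms(2)])+
  moreover have "rec_nat 0 (\<lambda>a s. s + m) n = n * m" for m n :: nat by (induction n) auto
  ultimately show ?thesis by simp
qed

lemma kcomp_pred:
  assumes "kcomp os \<phi>"
  shows "kcomp os (\<lambda>q. \<phi> q - 1)"
proof -
  note fl = kcomp_fixed_length[OF assms(1)]
  have "kcomp os (\<lambda>q. rec_nat 0 (\<lambda>a s. a) (\<phi> q))"
    by (rule kcomp_rec_nat[OF kcomp_const[OF fl] assms(1)]) (rule kcomp_bind2_var[OF fl])
  moreover have "rec_nat 0 (\<lambda>a s. a) n = n - 1" for n :: nat by (cases n) auto
  ultimately show ?thesis by simp
qed

lemma kcomp_diff:
  assumes "kcomp os \<phi>" "kcomp os \<psi>"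
  shows "kcomp os (\<lambda>q. \<phi> q - \<psi> q)"
proof -
  note fl = kcomp_fixed_length[OF assms(1)]
  have "kcomp os (\<lambda>q. rec_nat (\<phi> q) (\<lambda>a s. s - 1) (\<psi> q))"
    by (rule kcomp_rec_nat[OF assms], rule kcomp_pred) (rule kcomp_bind2_var[OF fl])
  moreover have "rec_nat m (\<lambda>a s. s - 1) n = m - n" for m n :: nat by (induction n) auto
  ultimately show ?thesis by simp
qed

text \<open>Truth is 0, in agreement with \<open>exists2\<close>.\<close>

definition kdec :: "('q \<Rightarrow> obj list) \<Rightarrow> ('q \<Rightarrow> bool) \<Rightarrow> bool" where
  "kdec os R \<longleftrightarrow> kcomp os (\<lambda>q. if R q then 0 else 1)"

lemma kcomp_if:
  assumes "kdec os R" "kcomp os \<phi>" "kcomp os \<psi>"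
  shows "kcomp os (\<lambda>q. if R q then \<phi> q else \<psi> q)"
proof -
  \<comment> \<open>Case distinction as recursion on the truth value: 0 returns the base, 1 the
    step.\<close>
  have "kcomp os (\<lambda>q. rec_nat (\<phi> q) (\<lambda>a s. \<psi> q) (if R q then 0 else 1))"
    by (rule kcomp_rec_nat[OF assms(2) assms(1)[unfolded kdec_def]]) (rule kcomp_bind2[OF assms(3)])
  then show ?thesis by (rule kcomp_cong) simp
qed

lemma kdec_fixed_length: "kdec os R \<Longrightarrow> fixed_length os"
  unfolding kdec_def by (rule kcomp_fixed_length)

lemma kdec_cong: "kdec os R \<Longrightarrow> (\<And>q. R q \<longleftrightarrow> S q) \<Longrightarrow> kdec os S"
  by (simp add: kdec_def)

lemma kdec_not:
  assumes "kdec os R"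
  shows "kdec os (\<lambda>q. \<not> R q)"
proof -
  have "kcomp os (\<lambda>q. if R q then 1 else 0)"
    by (rule kcomp_if[OF assms]) (rule kcomp_const[OF kdec_fixed_length[OF assms]])+
  then show ?thesis unfolding kdec_def by (rule kcomp_cong) simp
qed

lemma kdec_conj:
  assumes "kdec os R" "kdec os S"
  shows "kdec os (\<lambda>q. R q \<and> S q)"
proof -
  have "kcomp os (\<lambda>q. if R q then if S q then 0 else 1 else 1)"
    by (rule kcomp_if[OF assms(1)], fold kdec_def, rule assms(2))
      (rule kcomp_const[OF kdec_fixed_length[OF assms(1)]])
  then show ?thesis unfolding kdec_def by (rule kcomp_cong) simp
qed

lemma kdec_imp: "kdec os R \<Longrightarrow> kdec os S \<Longrightarrow> kdec os (\<lambda>q. R q \<longrightarrow> S q)"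
  by (rule kdec_cong[OF kdec_not[OF kdec_conj[OF _ kdec_not]]]) auto

lemma kdec_iff: "kdec os R \<Longrightarrow> kdec os S \<Longrightarrow> kdec os (\<lambda>q. R q \<longleftrightarrow> S q)"
  by (rule kdec_cong[OF kdec_conj[OF kdec_imp[of os R S] kdec_imp[of os S R]]]) auto

lemma kdec_le:
  assumes "kcomp os \<phi>" "kcomp os \<psi>"
  shows "kdec os (\<lambda>q. \<phi> q \<le> \<psi> q)"
proof -
  note fl = kcomp_fixed_length[OF assms(1)]
  have "kcomp os (\<lambda>q. 1 - (1 - (\<phi> q - \<psi> q)))"
    by (intro kcomp_diff kcomp_const fl assms)
  then show ?thesis unfolding kdec_def by (rule kcomp_cong) auto
qed

lemma kdec_less: "kcomp os \<phi> \<Longrightarrow> kcomp os \<psi> \<Longrightarrow> kdec os (\<lambda>q. \<phi> q < \<psi> q)"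
  by (rule kdec_cong[OF kdec_not[OF kdec_le[of os \<psi> \<phi>]]]) auto

lemma kdec_eq: "kcomp os \<phi> \<Longrightarrow> kcomp os \<psi> \<Longrightarrow> kdec os (\<lambda>q. \<phi> q = \<psi> q)"
  by (rule kdec_cong[OF kdec_conj[OF kdec_le[of os \<phi> \<psi>] kdec_le[of os \<psi> \<phi>]]]) auto

lemma kdec_ex:
  assumes "occurs os (\<lambda>q. Fun2 exists2)" "fixed_length os"
    and "kdec (\<lambda>z. Num (fst z) # os (snd z)) (\<lambda>z. R (fst z) (snd z))"
  shows "kdec os (\<lambda>q. \<exists>x. R x q)"
proof -
  have "kcomp os (\<lambda>q. exists2 (\<lambda>x. if R x q then 0 else 1))"
    using kcomp_Fun2[OF assms(1,2), of "\<lambda>x q. if R x q then 0 else 1"] assms(3)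
    by (simp add: kdec_def)
  then show ?thesis unfolding kdec_def by (rule kcomp_cong) (auto simp: exists2_def)
qed

lemma kdec_all:
  assumes "occurs os (\<lambda>q. Fun2 exists2)" "fixed_length os"
    and "kdec (\<lambda>z. Num (fst z) # os (snd z)) (\<lambda>z. R (fst z) (snd z))"
  shows "kdec os (\<lambda>q. \<forall>x. R x q)"
  by (rule kdec_cong[OF kdec_not[OF kdec_ex[OF assms(1,2) kdec_not[OF assms(3)]]]]) simp

section \<open>Pairing and comparison of coded rationals\<close>

lemma kcomp_triangle:
  assumes "kcomp os \<phi>"
  shows "kcomp os (\<lambda>q. triangle (\<phi> q))"
proof -
  note fl = kcomp_fixed_length[OF assms(1)]
  have "kcomp os (\<lambda>q. rec_nat 0 (\<lambda>a s. s + Suc a) (\<phi> q))"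
    by (rule kcomp_rec_nat[OF kcomp_const[OF fl] assms(1)], rule kcomp_add[OF _ kcomp_Suc])
      (rule kcomp_bind2_var[OF fl])+
  moreover have "rec_nat 0 (\<lambda>a s. s + Suc a) n = triangle n" for n by (induction n) auto
  ultimately show ?thesis by simp
qed

lemma kcomp_rat_code:
  assumes "kcomp os \<phi>" "kcomp os \<psi>"
  shows "kcomp os (\<lambda>q. rat_code (\<phi> q) (\<psi> q))"
  unfolding rat_code_def prod_encode_def prod.case
  by (intro kcomp_add kcomp_triangle kcomp_mult kcomp_const assms kcomp_fixed_length[OF assms(1)])

text \<open>The antidiagonal of the Cantor pairing on which \<open>n\<close> lies, that is, the sum
  of the two components of \<open>prod_decode n\<close>. It grows by at most one when
  \<open>n\<close> does, hence the recursion.\<close>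

definition diagonal :: "nat \<Rightarrow> nat" where
  "diagonal = rec_nat 0 (\<lambda>a s. if triangle (Suc s) \<le> Suc a then Suc s else s)"

lemma diagonal_bounds: "triangle (diagonal n) \<le> n \<and> n \<le> triangle (diagonal n) + diagonal n"
proof (induction n)
  case (Suc n)
  have "diagonal (Suc n) =
      (if triangle (Suc (diagonal n)) \<le> Suc n then Suc (diagonal n) else diagonal n)"
    by (simp add: diagonal_def)
  with Suc show ?case by (auto simp: not_le)
qed (simp add: diagonal_def)

lemma prod_decode_diagonal:
  "prod_decode n = (n - triangle (diagonal n), diagonal n - (n - triangle (diagonal n)))"
proof -
  have "prod_encode (n - triangle (diagonal n), diagonal n - (n - triangle (diagonal n))) = n"
    using diagonal_bounds[of n] by (simp add: prod_encode_def)
  then show ?thesis by (metis prod_encode_inverse)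
qed

lemma kcomp_diagonal:
  assumes "kcomp os \<phi>"
  shows "kcomp os (\<lambda>q. diagonal (\<phi> q))"
proof -
  note fl = kcomp_fixed_length[OF assms(1)]
  show ?thesis unfolding diagonal_def
    by (rule kcomp_rec_nat[OF kcomp_const[OF fl] assms])
      (intro kcomp_if kdec_le kcomp_triangle kcomp_Suc kcomp_bind2_var[OF fl])
qed

lemma kcomp_prod_decode:
  assumes "kcomp os \<phi>"
  shows "kcomp os (\<lambda>q. fst (prod_decode (\<phi> q)))" "kcomp os (\<lambda>q. snd (prod_decode (\<phi> q)))"
  unfolding prod_decode_diagonal fst_conv snd_conv
  by (intro kcomp_diff kcomp_triangle kcomp_diagonal assms)+

lemma kcomp_half:
  assumes "kcomp os \<phi>"
  shows "kcomp os (\<lambda>q. \<phi> q div 2)"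
proof -
  note fl = kcomp_fixed_length[OF assms(1)]
  \<comment> \<open>The recursion rests on (a + 1) div 2 = a - a div 2.\<close>
  have "kcomp os (\<lambda>q. rec_nat 0 (\<lambda>a s. a - s) (\<phi> q))"
    by (rule kcomp_rec_nat[OF kcomp_const[OF fl] assms(1)], rule kcomp_diff)
      (rule kcomp_bind2_var[OF fl])+
  moreover have "rec_nat 0 (\<lambda>a s. a - s) n = n div 2" for n :: nat
    by (induction n) simp_all
  ultimately show ?thesis by simp
qed

lemma kdec_even:
  assumes "kcomp os \<phi>"
  shows "kdec os (\<lambda>q. even (\<phi> q))"
proof -
  have "kdec os (\<lambda>q. 2 * (\<phi> q div 2) = \<phi> q)"
    by (intro kdec_eq kcomp_mult kcomp_half kcomp_const assms kcomp_fixed_length[OF assms])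
  then show ?thesis by (rule kdec_cong) presburger
qed

text \<open>\<open>int_decode\<close> maps even n to n/2 and odd n to -(n+1)/2; the absolute value
  is \<open>Suc n div 2\<close> in both cases. A quotient is nonnegative when the parities agree.
  The second component 0 stands for denominator 0, where the quotient is 0; it is represented as
  0/1.\<close>

definition abs_num :: "nat \<Rightarrow> nat" where
  "abs_num a = (if snd (prod_decode a) = 0 then 0 else Suc (fst (prod_decode a)) div 2)"

definition pos_num :: "nat \<Rightarrow> nat" where
  "pos_num a = (if even (fst (prod_decode a)) \<longleftrightarrow> even (snd (prod_decode a)) then abs_num a else 0)"

definition neg_num :: "nat \<Rightarrow> nat" where
  "neg_num a = (if even (fst (prod_decode a)) \<longleftrightarrow> even (snd (prod_decode a)) then 0 else abs_num a)"

definition denom :: "nat \<Rightarrow> nat" where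
  "denom a = (if snd (prod_decode a) = 0 then 1 else Suc (snd (prod_decode a)) div 2)"

lemma denom_pos: "denom a > 0"
  by (auto simp: denom_def)

lemma nat_to_rat_surj_eq:
  "nat_to_rat_surj a = (of_nat (pos_num a) - of_nat (neg_num a)) / of_nat (denom a)"
proof -
  have dec: "int_decode n = (if even n then int (Suc n div 2) else - int (Suc n div 2))" for n
    by (auto simp: int_decode_def sum_decode_def elim!: oddE)
  obtain x y where xy: "prod_decode a = (x, y)" by fastforce
  have q: "nat_to_rat_surj a = of_int (int_decode x) / of_int (int_decode y)"
    by (simp add: nat_to_rat_surj_def xy Fract_of_int_quotient)
  define X Y where "X = Suc x div 2" and "Y = Suc y div 2"
  have "int_decode x = (if even x then int X else - int X)"
    "int_decode y = (if even y then int Y else - int Y)" by (simp_all only: dec X_def Y_def)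
  moreover have "y = 0 \<Longrightarrow> Y = 0" by (simp add: Y_def)
  ultimately show ?thesis
    unfolding q pos_num_def neg_num_def abs_num_def denom_def xy fst_conv snd_conv
      X_def[symmetric] Y_def[symmetric]
    by (cases "even x"; cases "even y"; cases "y = 0"; simp)
qed

lemma kcomp_numerators:
  assumes "kcomp os \<phi>"
  shows "kcomp os (\<lambda>q. pos_num (\<phi> q))" "kcomp os (\<lambda>q. neg_num (\<phi> q))"
    "kcomp os (\<lambda>q. denom (\<phi> q))"
  unfolding pos_num_def neg_num_def denom_def abs_num_def
  by (intro kcomp_if kdec_iff kdec_even kdec_eq kcomp_half kcomp_Suc kcomp_prod_decode kcomp_const
      assms kcomp_fixed_length[OF assms])+

text \<open>The inequality a - b < c/d between coded rationals, multiplied out and with negative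
  terms moved across, so that it involves only sums and products of naturals.\<close>

definition diff_less :: "nat \<Rightarrow> nat \<Rightarrow> nat \<Rightarrow> nat \<Rightarrow> bool" where
  "diff_less c d a b \<longleftrightarrow>
     d * (pos_num a * denom b + neg_num b * denom a)
     < d * (pos_num b * denom a + neg_num a * denom b) + c * (denom a * denom b)"

lemma diff_less_iff:
  assumes "d > 0"
  shows "diff_less c d a b \<longleftrightarrow> nat_to_rat_surj a - nat_to_rat_surj b < of_nat c / of_nat d"
proof -
  define pa na da pb nb db :: rat where "pa = of_nat (pos_num a)" and "na = of_nat (neg_num a)"
    and "da = of_nat (denom a)" and "pb = of_nat (pos_num b)" and "nb = of_nat (neg_num b)"
    and "db = of_nat (denom b)"
  have pos: "da > 0" "db > 0" "(of_nat d :: rat) > 0"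
    using denom_pos assms by (simp_all add: da_def db_def)
  have "diff_less c d a b \<longleftrightarrow>
      of_nat d * (pa * db + nb * da) < of_nat d * (pb * da + na * db) + of_nat c * (da * db)"
    unfolding diff_less_def pa_def na_def da_def pb_def nb_def db_def
    by (simp flip: of_nat_mult of_nat_add)
  also have "\<dots> \<longleftrightarrow> (pa - na) / da - (pb - nb) / db < of_nat c / of_nat d"
  proof -
    have "(pa - na) / da - (pb - nb) / db = ((pa * db + nb * da) - (pb * da + na * db)) / (da * db)"
      using pos by (simp add: field_simps)
    moreover have "u / (da * db) < of_nat c / of_nat d \<longleftrightarrow> of_nat d * u < of_nat c * (da * db)" for u
      using pos by (simp add: divide_less_eq mult_pos_pos) (simp add: field_simps)
    ultimately show ?thesis by (simp add: right_diff_distrib less_diff_eq diff_less_eq add.commute)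
  qed
  finally show ?thesis
    unfolding nat_to_rat_surj_eq[of a] nat_to_rat_surj_eq[of b] pa_def na_def da_def pb_def nb_def db_def .
qed

lemma kdec_diff_less:
  assumes "kcomp os \<phi>" "kcomp os \<psi>"
  shows "kdec os (\<lambda>q. diff_less c d (\<phi> q) (\<psi> q))"
  unfolding diff_less_def
  by (intro kdec_less kcomp_add kcomp_mult kcomp_numerators kcomp_const assms kcomp_fixed_length[OF assms(1)])

lemma kdec_rat_less:
  assumes "kcomp os \<phi>" "kcomp os \<psi>"
  shows "kdec os (\<lambda>q. nat_to_rat_surj (\<phi> q) < nat_to_rat_surj (\<psi> q))"
  using kdec_diff_less[OF assms, of 0 1] by (rule kdec_cong) (simp add: diff_less_iff)

section \<open>Computing Cantor realisers\<close>

definition level_code ::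
    "((nat \<Rightarrow> nat) \<Rightarrow> nat) \<Rightarrow> ((nat \<Rightarrow> nat) \<Rightarrow> nat) \<Rightarrow> nat \<Rightarrow> (nat \<Rightarrow> nat) \<Rightarrow> nat \<Rightarrow> nat" where
  "level_code a y k \<alpha> n = rat_code (if a \<alpha> = 1 \<and> y \<alpha> = k then 1 else 0) 1"

definition level :: "real set \<Rightarrow> (real \<Rightarrow> nat) \<Rightarrow> nat \<Rightarrow> real set" where
  "level A Y k = {x \<in> A. Y x = k}"

lemma level_code_eq:
  "level_code (set_code A) (natfun_code Y) k =
     spike_code (set_code (level A Y k)) (natfun_code (\<lambda>_. 0))"
  by (intro ext) (simp add: level_code_def spike_code_def set_code_def natfun_code_def level_def)

lemma inj_on_level: "inj_on Y A \<Longrightarrow> inj_on (\<lambda>_. 0 :: nat) (level A Y k)"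
  by (auto simp: level_def inj_on_def)

lemma kcomp_Fun2_Seq:
  assumes H: "occurs os (\<lambda>q. Fun2 (H q))" and h: "occurs os (\<lambda>q. Seq (h q))" and fl: "fixed_length os"
  shows "kcomp os (\<lambda>q. H q (h q))"
proof -
  have "kcomp (\<lambda>z. Num (fst z) # os (snd z)) (\<lambda>z. h (snd z) (fst z))"
    by (rule kcomp_Seq[OF occurs_bind[OF h] kcomp_bind_var[OF fl]])
  from kcomp_Fun2[OF H fl, of "\<lambda>x q. h q x"] this show ?thesis by simp
qed

lemma kcomp_spike_code:
  assumes a: "occurs os (\<lambda>q. Fun2 (a q))" and y: "occurs os (\<lambda>q. Fun2 (y q))" and fl: "fixed_length os"
  shows "kcomp (\<lambda>z. Seq (fst z) # Num (fst (snd z)) # os (snd (snd z)))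
      (\<lambda>z. spike_code (a (snd (snd z))) (y (snd (snd z))) (fst z) (fst (snd z)))"
  unfolding spike_code_def
  by (intro kcomp_rat_code kcomp_if kdec_eq kcomp_const kcomp_Suc kcomp_Fun2_Seq[OF occurs_bind2[OF a]]
      kcomp_Fun2_Seq[OF occurs_bind2[OF y]] occurs_0 fixed_length_bind2 fl)

lemma kcomp_level_code:
  assumes a: "occurs os (\<lambda>q. Fun2 (a q))" and y: "occurs os (\<lambda>q. Fun2 (y q))" and k: "kcomp os k"
  shows "kcomp (\<lambda>z. Seq (fst z) # Num (fst (snd z)) # os (snd (snd z)))
      (\<lambda>z. level_code (a (snd (snd z))) (y (snd (snd z))) (k (snd (snd z))) (fst z) (fst (snd z)))"
  unfolding level_code_def
  by (intro kcomp_rat_code kcomp_if kdec_conj kdec_eq kcomp_const kcomp_bind2[OF k]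
      kcomp_Fun2_Seq[OF occurs_bind2[OF a]] kcomp_Fun2_Seq[OF occurs_bind2[OF y]]
      occurs_0 fixed_length_bind2 kcomp_fixed_length[OF k])

section \<open>Trisection towards a point outside \<open>A\<close>\<close>

text \<open>The value at \<open>k\<close> is the numerator, over 3^k, of the left endpoint of the
  current interval. Stage \<open>k\<close> takes the left third unless it contains the point of
  level \<open>k\<close>, and then the right third.\<close>

fun trisect :: "(nat \<Rightarrow> nat \<Rightarrow> nat \<Rightarrow> bool) \<Rightarrow> nat \<Rightarrow> nat" where
  "trisect hit 0 = 0"
| "trisect hit (Suc k) =
     3 * trisect hit k + (if hit k (3 * trisect hit k) (3 ^ Suc k) then 2 else 0)"

text \<open>The shift by one stage matters: the first trisection can move the left endpoint by 2/3,
  more than the 1/2 allowed for a code, whereas from stage 1 on the moves are small enough.\<close>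

definition trisect_code :: "(nat \<Rightarrow> nat \<Rightarrow> nat \<Rightarrow> bool) \<Rightarrow> nat \<Rightarrow> nat" where
  "trisect_code hit n = rat_code (trisect hit (Suc n)) (3 ^ Suc n)"

text \<open>The condition \<open>w < d\<close> keeps the tested interval inside the unit interval,
  where (b) and (c) say something.\<close>

definition locates :: "(nat \<Rightarrow> nat \<Rightarrow> nat \<Rightarrow> bool) \<Rightarrow> real set \<Rightarrow> (real \<Rightarrow> nat) \<Rightarrow> bool" where
  "locates hit A Y \<longleftrightarrow> (\<forall>k w d. w < d \<longrightarrow>
     (hit k w d \<longleftrightarrow> (\<exists>x\<in>A. Y x = k \<and> real w / real d \<le> x \<and> x \<le> real (Suc w) / real d)))"

lemma trisect_less: "trisect hit n < 3 ^ n"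
  by (induction n) auto

lemma trisect_bounds:
  "real (trisect hit n) / 3 ^ n \<le> real (trisect hit (Suc n)) / 3 ^ Suc n"
  "real (Suc (trisect hit (Suc n))) / 3 ^ Suc n \<le> real (Suc (trisect hit n)) / 3 ^ n"
  by (auto simp: field_simps)

text \<open>The intervals are nested, so the left endpoints converge to a point of all of them; they
  converge fast enough for the hat to leave the sequence unchanged.\<close>

lemma rval_trisect_code:
  "real (trisect hit n) / 3 ^ n \<le> rval (trisect_code hit)"
  "rval (trisect_code hit) \<le> real (Suc (trisect hit n)) / 3 ^ n"
proof -
  define l u where "l n = real (trisect hit n) / 3 ^ n"
    and "u n = real (Suc (trisect hit n)) / 3 ^ n" for n
  have inc: "incseq l" unfolding l_def by (intro incseq_SucI trisect_bounds)
  have dec: "decseq u" unfolding u_def by (intro decseq_SucI trisect_bounds)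
  have lu: "l n \<le> u n" for n by (simp add: l_def u_def divide_right_mono)
  have "l n \<le> u 0" for n using lu[of n] decseqD[OF dec, of 0 n] by simp
  then have "Bseq l" by (intro BseqI'[of _ "u 0"]) (auto simp: l_def)
  then obtain x where x: "l \<longlonglongrightarrow> x"
    using Bseq_monoseq_convergent incseq_imp_monoseq[OF inc] by (auto simp: convergent_def)
  have lx: "l n \<le> x" for n using incseq_le[OF inc x] .
  have xu: "x \<le> u n" for n
  proof (rule LIMSEQ_le_const2[OF x], intro exI[of _ n] allI impI)
    fix m assume "n \<le> m"
    then show "l m \<le> u n" using lu[of m] decseqD[OF dec, of n m] by simp
  qed
  have q: "nat_to_rat_surj (trisect_code hit n) =
      of_nat (trisect hit (Suc n)) / of_nat (3 ^ Suc n)" for n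
    unfolding trisect_code_def nat_to_rat_surj_rat_code ..
  have "rval (trisect_code hit) = x"
  proof (rule rval_eqI)
    show "(\<lambda>n. real_of_rat (nat_to_rat_surj (trisect_code hit n))) \<longlonglongrightarrow> x"
      using LIMSEQ_Suc[OF x]
      by (simp only: q l_def of_rat_divide of_rat_of_nat_eq of_nat_power of_nat_numeral
        of_rat_power of_rat_numeral_eq)
    fix k
    define w where "w = trisect hit (Suc k)"
    define b :: nat where "b = trisect hit (Suc (Suc k)) - 3 * w"
    have b: "trisect hit (Suc (Suc k)) = 3 * w + b" "b \<le> 2"
      by (auto simp: b_def w_def simp del: trisect.simps(2)) (simp_all add: trisect.simps(2)[of hit "Suc k"])
    have "nat_to_rat_surj (trisect_code hit k) - nat_to_rat_surj (trisect_code hit (Suc k))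
        = - (of_nat b / 3 ^ Suc (Suc k))"
      unfolding q b(1) w_def[symmetric] by (simp add: field_simps)
    then have "\<bar>nat_to_rat_surj (trisect_code hit k) - nat_to_rat_surj (trisect_code hit (Suc k))\<bar>
        = of_nat b / 3 ^ Suc (Suc k)" by simp
    also have "\<dots> \<le> 2 / 3 ^ Suc (Suc k)" using b(2) by (intro divide_right_mono) auto
    also have "\<dots> < (1/2) ^ Suc k"
    proof -
      have "(2::rat) ^ Suc k \<le> 3 ^ Suc k" by (intro power_mono) auto
      then have "(2::rat) * 2 ^ Suc k < 3 * 3 ^ Suc k"
        using zero_less_power[of "3::rat" "Suc k"] by linarith
      then show ?thesis by (simp add: field_simps power_divide)
    qed
    finally show "\<not> approx_fails (trisect_code hit) k" by (simp add: approx_fails_def)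
  qed
  with lx[of n] xu[of n] show "real (trisect hit n) / 3 ^ n \<le> rval (trisect_code hit)"
    "rval (trisect_code hit) \<le> real (Suc (trisect hit n)) / 3 ^ n"
    by (simp_all add: l_def u_def)
qed

text \<open>If the limit were in \<open>A\<close>, the stage numbered by its \<open>Y\<close>-value
  would have avoided it.\<close>

lemma trisect_avoids:
  assumes hit: "locates hit A Y" and Y: "inj_on Y A"
  shows "rval (trisect_code hit) \<in> {0..1} - A"
proof -
  let ?x = "rval (trisect_code hit)"
  have "0 \<le> ?x" "?x \<le> 1" using rval_trisect_code[where n = 0, of hit] by auto
  moreover have "?x \<notin> A"
  proof
    assume xA: "?x \<in> A"
    define k where "k = Y ?x"
    define w where "w = trisect hit k"
    have "w < 3 ^ k" unfolding w_def by (rule trisect_less)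
    then have "3 * w < 3 ^ Suc k" by simp
    then have iff: "hit k (3 * w) (3 ^ Suc k) \<longleftrightarrow>
        (\<exists>x\<in>A. Y x = k \<and> real (3 * w) / 3 ^ Suc k \<le> x \<and> x \<le> real (Suc (3 * w)) / 3 ^ Suc k)"
      using hit unfolding locates_def by (metis of_nat_numeral of_nat_power)
    show False
    proof (cases "hit k (3 * w) (3 ^ Suc k)")
      case True
      then obtain x where "x \<in> A" "Y x = k" "x \<le> real (Suc (3 * w)) / 3 ^ Suc k" using iff by blast
      moreover from this have "x = ?x" using Y xA by (auto simp: k_def inj_on_def)
      \<comment> \<open>The only point of level \<open>k\<close> is the limit itself, but the middle
        third separates the limit from the left third.\<close>
      moreover have "real (3 * w + 2) / 3 ^ Suc k \<le> ?x"
        using rval_trisect_code(1)[of hit "Suc k"] True by (simp add: w_def add.commute)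
      ultimately have "real (3 * w + 2) / 3 ^ Suc k \<le> real (Suc (3 * w)) / 3 ^ Suc k" by linarith
      then show False by (simp add: divide_le_cancel)
    next
      case False
      then have "real (3 * w) / 3 ^ Suc k \<le> ?x" "?x \<le> real (Suc (3 * w)) / 3 ^ Suc k"
        using rval_trisect_code[of hit "Suc k"] by (simp_all add: w_def)
      with xA False iff show False by (auto simp: k_def)
    qed
  qed
  ultimately show ?thesis by simp
qed

lemma cantor_realiserI:
  assumes "\<And>A Y. A \<subseteq> {0..1} \<Longrightarrow> inj_on Y A \<Longrightarrow> locates (hit (set_code A) (natfun_code Y)) A Y"
  shows "cantor_realiser (\<lambda>a y. trisect_code (hit a y))"
  unfolding cantor_realiser_def using assms trisect_avoids by blast

lemma kcomp_power:
  assumes "kcomp os \<phi>"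
  shows "kcomp os (\<lambda>q. c ^ \<phi> q)"
proof -
  note fl = kcomp_fixed_length[OF assms]
  have "kcomp os (\<lambda>q. rec_nat 1 (\<lambda>a s. c * s) (\<phi> q))"
    by (rule kcomp_rec_nat[OF kcomp_const[OF fl] assms], rule kcomp_mult)
      (rule kcomp_bind2_var[OF fl] kcomp_const[OF fixed_length_bind2[OF fl]])+
  moreover have "rec_nat 1 (\<lambda>a s. c * s) n = c ^ n" for n :: nat by (induction n) auto
  ultimately show ?thesis by simp
qed

text \<open>The recursion asks about left thirds only, so \<open>hit\<close> has to be decided just
  at those numerators and denominators.\<close>

lemma kcomp_trisect_code:
  assumes \<phi>: "kcomp os \<phi>"
    and hit: "kdec (\<lambda>z. Num (fst z) # Num (fst (snd z)) # os (snd (snd z)))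
      (\<lambda>z. hit (snd (snd z)) (fst z) (3 * fst (snd z)) (3 ^ Suc (fst z)))"
  shows "kcomp os (\<lambda>q. trisect_code (hit q) (\<phi> q))"
proof -
  note fl = kcomp_fixed_length[OF \<phi>]
  note fl2 = fixed_length_bind2[OF fl]
  have "kcomp os (\<lambda>q. rec_nat 0 (\<lambda>k w. 3 * w + (if hit q k (3 * w) (3 ^ Suc k) then 2 else 0)) (Suc (\<phi> q)))"
    by (rule kcomp_rec_nat[OF kcomp_const[OF fl] kcomp_Suc[OF \<phi>]])
      (intro kcomp_add kcomp_mult kcomp_if hit kcomp_const[OF fl2] kcomp_bind2_var[OF fl])
  moreover have "rec_nat 0 (\<lambda>k w. 3 * w + (if h k (3 * w) (3 ^ Suc k) then 2 else 0)) n = trisect h n"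
    for h n by (induction n) auto
  ultimately have "kcomp os (\<lambda>q. trisect (hit q) (Suc (\<phi> q)))" by simp
  then show ?thesis
    unfolding trisect_code_def by (intro kcomp_rat_code kcomp_power kcomp_Suc \<phi>)
qed

lemma computable_cantorI:
  assumes "kcomp (\<lambda>q. os @ [Fun2 (fst q), Fun2 (fst (snd q)), Num (snd (snd q))])
    (\<lambda>q. \<Theta> (fst q) (fst (snd q)) (snd (snd q)))"
  shows "computable_cantor os \<Theta>"
proof -
  obtain e where "\<And>q. kleene e (os @ [Fun2 (fst q), Fun2 (fst (snd q)), Num (snd (snd q))])
      (\<Theta> (fst q) (fst (snd q)) (snd (snd q)))" using assms by (auto simp: kcomp_def)
  from this[of "(a, y, n)" for a y n] show ?thesis by (auto simp: computable_cantor_def)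
qed

text \<open>The second term of the hat of a code is closer than \<open>1/2\<close> to the coded real; this separates
  the values 0 and 1.\<close>

definition unit_hit :: "nat \<Rightarrow> nat \<Rightarrow> bool" where
  "unit_hit a b \<longleftrightarrow> nat_to_rat_surj (rat_code 1 2) <
     nat_to_rat_surj (if diff_less 1 2 a b \<and> diff_less 1 2 b a then b else a)"

lemma unit_hit:
  assumes "rval \<sigma> = 0 \<or> rval \<sigma> = 1"
  shows "unit_hit (\<sigma> 0) (\<sigma> 1) \<longleftrightarrow> rval \<sigma> = 1"
proof -
  \<comment> \<open>Term 1 of the hat depends only on whether the code already fails at 0, which is
    a comparison of its first two rationals.\<close>
  have hat1: "hat \<sigma> 1 = nat_to_rat_surj (if diff_less 1 2 (\<sigma> 0) (\<sigma> 1) \<and> diff_less 1 2 (\<sigma> 1) (\<sigma> 0)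
      then \<sigma> 1 else \<sigma> 0)"
  proof -
    define a b where "a = nat_to_rat_surj (\<sigma> 0)" and "b = nat_to_rat_surj (\<sigma> 1)"
    have "diff_less 1 2 (\<sigma> 0) (\<sigma> 1) \<and> diff_less 1 2 (\<sigma> 1) (\<sigma> 0) \<longleftrightarrow> a - b < 1/2 \<and> b - a < 1/2"
      by (simp only: diff_less_iff[OF zero_less_numeral] of_nat_1 of_nat_numeral a_def b_def)
    also have "\<dots> \<longleftrightarrow> \<bar>a - b\<bar> < 1/2" by (auto simp only: abs_less_iff minus_diff_eq)
    also have "\<dots> \<longleftrightarrow> \<not> approx_fails \<sigma> 0" by (simp add: approx_fails_def a_def b_def)
    finally have "diff_less 1 2 (\<sigma> 0) (\<sigma> 1) \<and> diff_less 1 2 (\<sigma> 1) (\<sigma> 0) \<longleftrightarrow> \<not> approx_fails \<sigma> 0" .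
    moreover have "approx_fails \<sigma> 0 \<Longrightarrow> (LEAST k. approx_fails \<sigma> k) = 0" by (simp add: Least_eq_0)
    ultimately show ?thesis by (auto simp: hat_def)
  qed
  have step: "\<bar>real_of_rat (hat \<sigma> n) - real_of_rat (hat \<sigma> (Suc n))\<bar> < (1/2) ^ Suc n" for n
  proof -
    have "real_of_rat \<bar>hat \<sigma> n - hat \<sigma> (Suc n)\<bar> < real_of_rat ((1/2) ^ Suc n)"
      using hat_step by (simp only: of_rat_less)
    then show ?thesis
      by (simp add: of_rat_abs_real of_rat_diff of_rat_power of_rat_divide of_rat_mult)
  qed
  \<comment> \<open>The limit only yields a weak bound, so the tail is estimated from term 2 on; the
    strict step from term 1 to term 2 then gives a strict distance below 1/2.\<close>
  have "\<bar>real_of_rat (hat \<sigma> 2) - real_of_rat (hat \<sigma> (2 + n))\<bar> \<le> 1/4 - (1/2) ^ (n + 2)" for n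
  proof (induction n)
    case (Suc n)
    have "\<bar>real_of_rat (hat \<sigma> (2 + n)) - real_of_rat (hat \<sigma> (2 + Suc n))\<bar> < (1/2) ^ (Suc n + 2)"
      using step[of "2 + n"] by (simp add: add.commute)
    moreover have "(1/2::real) ^ (n + 2) = 2 * (1/2) ^ (Suc n + 2)" by simp
    ultimately show ?case using Suc by linarith
  qed simp
  then have "\<bar>real_of_rat (hat \<sigma> 2) - real_of_rat (hat \<sigma> (n + 2))\<bar> \<le> 1/4" for n
    using zero_less_power[of "1/2::real" "n + 2"] by (smt (verit) add.commute zero_less_divide_1_iff)
  moreover have "(\<lambda>n. \<bar>real_of_rat (hat \<sigma> 2) - real_of_rat (hat \<sigma> (n + 2))\<bar>) \<longlonglongrightarrow>
      \<bar>real_of_rat (hat \<sigma> 2) - rval \<sigma>\<bar>"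
    by (intro tendsto_intros LIMSEQ_ignore_initial_segment hat_tendsto_rval)
  ultimately have "\<bar>real_of_rat (hat \<sigma> 2) - rval \<sigma>\<bar> \<le> 1/4" by (intro LIMSEQ_le_const2) auto
  moreover have "\<bar>real_of_rat (hat \<sigma> 1) - real_of_rat (hat \<sigma> 2)\<bar> < 1/4"
    using step[of 1] by (simp add: numeral_2_eq_2 power2_eq_square)
  moreover have "unit_hit (\<sigma> 0) (\<sigma> 1) \<longleftrightarrow> 1/2 < real_of_rat (hat \<sigma> 1)"
  proof -
    have "unit_hit (\<sigma> 0) (\<sigma> 1) \<longleftrightarrow> 1/2 < hat \<sigma> 1"
      by (simp only: unit_hit_def hat1 nat_to_rat_surj_rat_code) simp
    also have "\<dots> \<longleftrightarrow> real_of_rat (1/2) < real_of_rat (hat \<sigma> 1)" by (simp only: of_rat_less)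
    finally show ?thesis by (simp add: of_rat_divide)
  qed
  ultimately show ?thesis using assms by linarith
qed

section \<open>Locating the point of a level by suprema\<close>

definition sup_hit ::
    "(((nat \<Rightarrow> nat) \<Rightarrow> nat \<Rightarrow> nat) \<Rightarrow> (nat \<Rightarrow> nat) \<Rightarrow> (nat \<Rightarrow> nat) \<Rightarrow> nat \<Rightarrow> nat) \<Rightarrow>
    ((nat \<Rightarrow> nat) \<Rightarrow> nat) \<Rightarrow> ((nat \<Rightarrow> nat) \<Rightarrow> nat) \<Rightarrow> nat \<Rightarrow> nat \<Rightarrow> nat \<Rightarrow> bool" where
  "sup_hit \<Psi> a y k w d \<longleftrightarrow>
     (let \<sigma> = \<Psi> (level_code a y k) (\<lambda>_. rat_code w d) (\<lambda>_. rat_code (Suc w) d) in unit_hit (\<sigma> 0) (\<sigma> 1))"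

text \<open>The supremum of the indicator of a level over the interval is 1 or 0 according to
  whether the interval contains the point, and \<open>unit_hit\<close> tells these apart.\<close>

lemma locates_sup_hit:
  assumes \<Psi>: "sup_functional \<Psi>" and Y: "inj_on Y A"
  shows "locates (sup_hit \<Psi> (set_code A) (natfun_code Y)) A Y"
  unfolding locates_def
proof (intro allI impI)
  fix k w d :: nat assume wd: "w < d"
  let ?f = "spike (level A Y k) (\<lambda>_. 0)"
  let ?J = "{real w / real d..real (Suc w) / real d}"
  define \<sigma> where "\<sigma> = \<Psi> (level_code (set_code A) (natfun_code Y) k)
    (\<lambda>_. rat_code w d) (\<lambda>_. rat_code (Suc w) d)"
  have J: "0 \<le> real w / real d" "real w / real d \<le> real (Suc w) / real d" "real (Suc w) / real d \<le> 1"
    using wd by (simp_all add: field_simps)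
  have \<sigma>: "rval \<sigma> = (SUP x\<in>?J. ?f x)"
    using \<Psi>[unfolded sup_functional_def, rule_format,
        of "level_code (set_code A) (natfun_code Y) k" ?f "\<lambda>_. rat_code w d" "\<lambda>_. rat_code (Suc w) d"] J
    unfolding \<sigma>_def level_code_eq rval_rat_code
    by (simp only: codes_fun_spike cliquish_spike[OF inj_on_level[OF Y]] simp_thms)
  have "rval \<sigma> = (if ?J \<inter> level A Y k = {} then 0 else 1)"
  proof (cases "?J \<inter> level A Y k = {}")
    case True
    then have "(SUP x\<in>?J. ?f x) = (SUP x\<in>?J. 0)" by (intro SUP_cong) (auto simp: spike_def)
    then show ?thesis using True J(2) \<sigma> by simp
  next
    case False
    then obtain x where x: "x \<in> ?J" "x \<in> level A Y k" by blast
    then have fx: "?f x = 1" by (simp add: spike_def)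
    have "bdd_above (?f ` ?J)" by (rule bdd_aboveI2[where M = 1]) (rule spike_bounds)
    then have "1 \<le> (SUP x\<in>?J. ?f x)" using x(1) fx by (metis cSUP_upper)
    moreover have "(SUP x\<in>?J. ?f x) \<le> 1" using x(1) by (intro cSUP_least spike_bounds) blast
    ultimately show ?thesis using False \<sigma> by simp
  qed
  then have "unit_hit (\<sigma> 0) (\<sigma> 1) \<longleftrightarrow> ?J \<inter> level A Y k \<noteq> {}"
    by (subst unit_hit) (auto split: if_splits)
  then show "sup_hit \<Psi> (set_code A) (natfun_code Y) k w d \<longleftrightarrow>
      (\<exists>x\<in>A. Y x = k \<and> real w / real d \<le> x \<and> x \<le> real (Suc w) / real d)"
    by (auto simp: sup_hit_def \<sigma>_def[symmetric] level_def)
qed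

lemma kdec_sup_hit:
  assumes \<Psi>: "occurs os (\<lambda>q. OpRR \<Psi>)" and a: "occurs os (\<lambda>q. Fun2 (a q))"
    and y: "occurs os (\<lambda>q. Fun2 (y q))"
    and k: "kcomp os k" and w: "kcomp os w" and d: "kcomp os d"
  shows "kdec os (\<lambda>q. sup_hit \<Psi> (a q) (y q) (k q) (w q) (d q))"
proof -
  have "kcomp os (\<lambda>q. \<Psi> (level_code (a q) (y q) (k q)) (\<lambda>_. rat_code (w q) (d q))
      (\<lambda>_. rat_code (Suc (w q)) (d q)) i)" for i
    by (rule kcomp_OpRR[OF \<Psi> kcomp_level_code[OF a y k]])
      (intro kcomp_rat_code kcomp_Suc kcomp_bind[OF w] kcomp_bind[OF d]
        kcomp_const[OF kcomp_fixed_length[OF k]])+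
  then show ?thesis
    unfolding sup_hit_def unit_hit_def Let_def
    by (intro kdec_rat_less kcomp_if kdec_conj kdec_diff_less kcomp_rat_code
        kcomp_const[OF kcomp_fixed_length[OF k]])
qed

section \<open>Locating the point of a level by a representation of the continuity points\<close>

definition in_interval :: "nat \<Rightarrow> nat \<Rightarrow> bool" where
  "in_interval i c \<longleftrightarrow> nat_to_rat_surj (fst (prod_decode i)) < nat_to_rat_surj c \<and>
     nat_to_rat_surj c < nat_to_rat_surj (snd (prod_decode i))"

lemma in_interval_iff: "in_interval i c \<longleftrightarrow> real_of_rat (nat_to_rat_surj c) \<in> rat_interval i"
  by (simp add: in_interval_def rat_interval_def of_rat_less split: prod.split)

text \<open>An arithmetical form of covering a compact interval, decidable with
  \<open>exists2\<close>. The bound \<open>M\<close> precedes the rational \<open>c\<close>: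
  covering the rationals one by one could still miss an irrational point.\<close>

definition covers :: "(nat \<Rightarrow> nat) \<Rightarrow> nat \<Rightarrow> nat \<Rightarrow> bool" where
  "covers I p q \<longleftrightarrow> (\<exists>M. \<forall>c. \<not> nat_to_rat_surj c < nat_to_rat_surj p \<and>
     \<not> nat_to_rat_surj q < nat_to_rat_surj c \<longrightarrow> (\<exists>m. m \<le> M \<and> in_interval (I m) c))"

text \<open>If finitely many open intervals leave a point \<open>y\<close> of \<open>[p, q]\<close> uncovered, then they also leave
  the largest of the numbers below \<open>y\<close> among \<open>p\<close> and their right endpoints uncovered.\<close>

lemma covers_iff:
  assumes p: "real_of_rat (nat_to_rat_surj p) = u" and q: "real_of_rat (nat_to_rat_surj q) = v"
  shows "covers I p q \<longleftrightarrow> {u..v} \<subseteq> (\<Union>m. rat_interval (I m))"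
proof
  assume "covers I p q"
  then obtain M where M: "\<And>c. u \<le> real_of_rat (nat_to_rat_surj c) \<Longrightarrow>
      real_of_rat (nat_to_rat_surj c) \<le> v \<Longrightarrow> \<exists>m\<le>M. real_of_rat (nat_to_rat_surj c) \<in> rat_interval (I m)"
    unfolding covers_def in_interval_iff by (auto simp: not_less of_rat_less_eq simp flip: p q)
  show "{u..v} \<subseteq> (\<Union>m. rat_interval (I m))"
  proof (rule ccontr)
    assume "\<not> ?thesis"
    then obtain y where "y \<in> {u..v}" and unc: "y \<notin> (\<Union>m. rat_interval (I m))" by blast
    then have y: "u \<le> y" "y \<le> v" by simp_all
    define l r where "l m = real_of_rat (nat_to_rat_surj (fst (prod_decode (I m))))"
      and "r m = real_of_rat (nat_to_rat_surj (snd (prod_decode (I m))))" for m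
    have I: "rat_interval (I m) = {l m<..<r m}" for m
      by (simp add: rat_interval_def l_def r_def split: prod.split)
    define R where "R = insert u {r m | m. m \<le> M \<and> r m \<le> y}"
    have "finite R" "R \<noteq> {}" by (auto simp: R_def)
    define x where "x = Max R"
    have x: "x \<in> R" unfolding x_def by (rule Max_in) fact+
    have Rx: "t \<le> x" if "t \<in> R" for t unfolding x_def by (rule Max_ge) (fact, fact that)
    have "x \<le> y" "u \<le> x" using x y Rx by (auto simp: R_def)
    \<comment> \<open>As \<open>u\<close> or a right endpoint, \<open>x\<close> is rational, so the
      assumption on rational points applies to it.\<close>
    obtain c where c: "x = real_of_rat (nat_to_rat_surj c)" using x p by (auto simp: R_def r_def)
    obtain m where "m \<le> M" "l m < x" "x < r m"
      using M[of c] \<open>u \<le> x\<close> \<open>x \<le> y\<close> y(2) by (auto simp: c[symmetric] I)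
    have "y \<notin> {l m<..<r m}" using unc I by blast
    then have "r m \<le> y" using \<open>l m < x\<close> \<open>x \<le> y\<close> by simp
    then have "r m \<in> R" using \<open>m \<le> M\<close> by (auto simp: R_def)
    then have "r m \<le> x" by (rule Rx)
    then show False using \<open>x < r m\<close> by simp
  qed
next
  assume cov: "{u..v} \<subseteq> (\<Union>m. rat_interval (I m))"
  have op: "open (rat_interval i)" for i by (simp add: rat_interval_def split: prod.split)
  obtain D where D: "finite D" "{u..v} \<subseteq> (\<Union>m\<in>D. rat_interval (I m))"
    by (rule compactE_image[OF compact_Icc op cov])
  have "\<exists>m\<le>Max D. real_of_rat (nat_to_rat_surj c) \<in> rat_interval (I m)"
    if "u \<le> real_of_rat (nat_to_rat_surj c)" "real_of_rat (nat_to_rat_surj c) \<le> v" for c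
  proof -
    have "real_of_rat (nat_to_rat_surj c) \<in> {u..v}" using that by simp
    then obtain m where "m \<in> D" "real_of_rat (nat_to_rat_surj c) \<in> rat_interval (I m)"
      using D(2) by blast
    then show ?thesis using Max_ge[OF D(1)] by blast
  qed
  then show "covers I p q"
    unfolding covers_def in_interval_iff by (auto simp: not_less of_rat_less_eq simp flip: p q)
qed

definition Gdelta_hit ::
    "(((nat \<Rightarrow> nat) \<Rightarrow> nat \<Rightarrow> nat) \<Rightarrow> nat \<Rightarrow> nat \<Rightarrow> nat) \<Rightarrow>
    ((nat \<Rightarrow> nat) \<Rightarrow> nat) \<Rightarrow> ((nat \<Rightarrow> nat) \<Rightarrow> nat) \<Rightarrow> nat \<Rightarrow> nat \<Rightarrow> nat \<Rightarrow> bool" where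
  "Gdelta_hit \<zeta> a y k w d \<longleftrightarrow>
     (\<exists>n. \<not> covers (\<lambda>m. \<zeta> (level_code a y k) m n) (rat_code w d) (rat_code (Suc w) d))"

text \<open>The interval misses the level exactly if it consists of continuity points of the
  indicator, that is, if each of the open sets in the representation covers it.\<close>

lemma locates_Gdelta_hit:
  assumes \<zeta>: "Gdelta_functional \<zeta>" and Y: "inj_on Y A"
  shows "locates (Gdelta_hit \<zeta> (set_code A) (natfun_code Y)) A Y"
  unfolding locates_def
proof (intro allI impI)
  fix k w d :: nat assume wd: "w < d"
  let ?F = "level_code (set_code A) (natfun_code Y) k"
  let ?J = "{real w / real d..real (Suc w) / real d}"
  have "0 \<le> real w / real d" "real (Suc w) / real d \<le> 1" using wd by (simp_all add: field_simps)
  then have J: "?J \<subseteq> {0..1}" by (simp only: atLeastatMost_subset_iff) blast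
  have "cont_points (spike (level A Y k) (\<lambda>_. 0)) = (\<Inter>n. \<Union>m. rat_interval (\<zeta> ?F m n))"
    using \<zeta>[unfolded Gdelta_functional_def, rule_format, of ?F "spike (level A Y k) (\<lambda>_. 0)"]
    unfolding level_code_eq
    by (simp only: codes_fun_spike cliquish_spike[OF inj_on_level[OF Y]] simp_thms)
  then have C: "(\<Inter>n. \<Union>m. rat_interval (\<zeta> ?F m n)) = {0..1} - level A Y k"
    by (simp only: cont_points_spike[OF inj_on_level[OF Y]])
  have q: "real_of_rat (nat_to_rat_surj (rat_code v d)) = real v / real d" for v
    by (simp add: nat_to_rat_surj_rat_code of_rat_divide)
  have "Gdelta_hit \<zeta> (set_code A) (natfun_code Y) k w d \<longleftrightarrow>
      \<not> ?J \<subseteq> (\<Inter>n. \<Union>m. rat_interval (\<zeta> ?F m n))"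
    by (simp only: Gdelta_hit_def covers_iff[OF q q] le_INF_iff ball_UNIV not_all)
  also have "\<dots> \<longleftrightarrow> ?J \<inter> level A Y k \<noteq> {}" unfolding C by (simp only: Diff_eq Int_subset_iff J simp_thms disjoint_eq_subset_Compl)
  finally show "Gdelta_hit \<zeta> (set_code A) (natfun_code Y) k w d \<longleftrightarrow>
      (\<exists>x\<in>A. Y x = k \<and> real w / real d \<le> x \<and> x \<le> real (Suc w) / real d)"
    by (auto simp: level_def)
qed

lemma kdec_in_interval: "kcomp os i \<Longrightarrow> kcomp os c \<Longrightarrow> kdec os (\<lambda>q. in_interval (i q) (c q))"
  unfolding in_interval_def by (intro kdec_conj kdec_rat_less kcomp_prod_decode)

lemma kcomp_skip:
  assumes "kcomp (\<lambda>q. x q # os q) \<phi>"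
  shows "kcomp (\<lambda>q. x q # y q # os q) \<phi>"
proof -
  have "fixed_length (\<lambda>q. x q # os q)" using assms by (rule kcomp_fixed_length)
  then obtain L where "\<And>q. Suc (length (os q)) = L" by (auto simp: fixed_length_def)
  then have L: "length (os q) = L - 1" for q by (metis diff_Suc_1)
  let ?js = "0 # map (\<lambda>i. Suc (Suc i)) [0..<L - 1]"
  have eq: "map ((!) (x q # y q # os q)) ?js = x q # os q" for q
    using map_nth[of "os q"] by (simp add: L o_def)
  show ?thesis
  proof (rule kcomp_select)
    show "kcomp (\<lambda>q. map ((!) (x q # y q # os q)) ?js) \<phi>" unfolding eq by (rule assms)
  qed (auto simp: L distinct_map fixed_length_def inj_on_def)
qed

lemma kdec_covers:
  assumes E: "occurs os (\<lambda>q. Fun2 exists2)" and p: "kcomp os p" and r: "kcomp os r"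
    and I: "kcomp (\<lambda>z. Num (fst z) # os (snd z)) (\<lambda>z. I (fst z) (snd z))"
  shows "kdec os (\<lambda>q. covers (\<lambda>m. I m q) (p q) (r q))"
proof -
  note fl = kcomp_fixed_length[OF p]
  let ?os1 = "\<lambda>z. Num (fst z) # os (snd z)"
  let ?os2 = "\<lambda>z. Num (fst z) # ?os1 (snd z)"
  let ?os3 = "\<lambda>z. Num (fst z) # ?os2 (snd z)"
  have fl1: "fixed_length ?os1" by (rule fixed_length_bind[OF fl])
  have fl2: "fixed_length ?os2" by (rule fixed_length_bind[OF fl1])
  have E1: "occurs ?os1 (\<lambda>q. Fun2 exists2)" by (rule occurs_bind[OF E])
  have E2: "occurs ?os2 (\<lambda>q. Fun2 exists2)" by (rule occurs_bind[OF E1])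
  have m: "kcomp ?os3 fst" by (rule kcomp_bind_var[OF fl2])
  have c: "kcomp ?os2 fst" by (rule kcomp_bind_var[OF fl1])
  have M: "kcomp ?os1 fst" by (rule kcomp_bind_var[OF fl])
  \<comment> \<open>\<open>I\<close> expects its number directly before \<open>os\<close>, but two
    further bound numbers stand in between. A copy of \<open>m\<close> is put in front, and the
    three numbers behind it are skipped.\<close>
  have I3: "kcomp ?os3 (\<lambda>z. I (fst z) (snd (snd (snd z))))"
  proof (rule kcomp_let[OF m])
    have "kcomp (\<lambda>z. Num (fst z) # os (snd (snd (snd z)))) (\<lambda>z. I (fst z) (snd (snd (snd z))))"
      using kcomp_subst[OF I, of "\<lambda>z. (fst z, snd (snd (snd z)))"] by simp
    then show "kcomp (\<lambda>z. Num (fst z) # ?os3 z) (\<lambda>z. I (fst z) (snd (snd (snd z))))"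
      by (intro kcomp_skip)
  qed
  have "kdec ?os3 (\<lambda>z. fst z \<le> fst (snd (snd z)) \<and> in_interval (I (fst z) (snd (snd (snd z)))) (fst (snd z)))"
    by (intro kdec_conj kdec_le kdec_in_interval m I3 kcomp_bind[OF c] kcomp_bind[OF kcomp_bind[OF M]])
  then have "kdec ?os2 (\<lambda>z. \<exists>m. m \<le> fst (snd z) \<and> in_interval (I m (snd (snd z))) (fst z))"
    using kdec_ex[OF E2 fl2, of "\<lambda>m z. m \<le> fst (snd z) \<and> in_interval (I m (snd (snd z))) (fst z)"] by simp
  then have "kdec ?os2 (\<lambda>z. \<not> nat_to_rat_surj (fst z) < nat_to_rat_surj (p (snd (snd z))) \<and>
      \<not> nat_to_rat_surj (r (snd (snd z))) < nat_to_rat_surj (fst z) \<longrightarrow>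
      (\<exists>m. m \<le> fst (snd z) \<and> in_interval (I m (snd (snd z))) (fst z)))"
    by (intro kdec_imp kdec_conj kdec_not kdec_rat_less c
        kcomp_bind[OF kcomp_bind[OF p]] kcomp_bind[OF kcomp_bind[OF r]])
  then have "kdec ?os1 (\<lambda>z. \<forall>c. \<not> nat_to_rat_surj c < nat_to_rat_surj (p (snd z)) \<and>
      \<not> nat_to_rat_surj (r (snd z)) < nat_to_rat_surj c \<longrightarrow>
      (\<exists>m. m \<le> fst z \<and> in_interval (I m (snd z)) c))"
    using kdec_all[OF E1 fl1, of "\<lambda>c z. \<not> nat_to_rat_surj c < nat_to_rat_surj (p (snd z)) \<and>
      \<not> nat_to_rat_surj (r (snd z)) < nat_to_rat_surj c \<longrightarrow>
      (\<exists>m. m \<le> fst z \<and> in_interval (I m (snd z)) c)"] by simp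
  then show ?thesis
    unfolding covers_def
    using kdec_ex[OF E fl, of "\<lambda>M q. \<forall>c. \<not> nat_to_rat_surj c < nat_to_rat_surj (p q) \<and>
      \<not> nat_to_rat_surj (r q) < nat_to_rat_surj c \<longrightarrow> (\<exists>m. m \<le> M \<and> in_interval (I m q) c)"] by simp
qed

lemma kdec_Gdelta_hit:
  assumes E: "occurs os (\<lambda>q. Fun2 exists2)" and \<zeta>: "occurs os (\<lambda>q. OpNN \<zeta>)"
    and a: "occurs os (\<lambda>q. Fun2 (a q))" and y: "occurs os (\<lambda>q. Fun2 (y q))"
    and k: "kcomp os k" and w: "kcomp os w" and d: "kcomp os d"
  shows "kdec os (\<lambda>q. Gdelta_hit \<zeta> (a q) (y q) (k q) (w q) (d q))"
proof -
  note fl = kcomp_fixed_length[OF k]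
  let ?os1 = "\<lambda>z. Num (fst z) # os (snd z)"
  let ?os2 = "\<lambda>z. Num (fst z) # ?os1 (snd z)"
  have fl1: "fixed_length ?os1" by (rule fixed_length_bind[OF fl])
  have E1: "occurs ?os1 (\<lambda>q. Fun2 exists2)" by (rule occurs_bind[OF E])
  have n: "kcomp ?os1 fst" by (rule kcomp_bind_var[OF fl])
  have m: "kcomp ?os2 fst" by (rule kcomp_bind_var[OF fl1])
  have "kcomp ?os2 (\<lambda>z. \<zeta> (level_code (a (snd (snd z))) (y (snd (snd z))) (k (snd (snd z))))
      (fst z) (fst (snd z)))"
    by (rule kcomp_OpNN[OF occurs_bind[OF occurs_bind[OF \<zeta>]] kcomp_level_code[OF
          occurs_bind[OF occurs_bind[OF a]] occurs_bind[OF occurs_bind[OF y]] kcomp_bind[OF kcomp_bind[OF k]]]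
          m kcomp_bind[OF n]])
  then have "kdec ?os1 (\<lambda>z. \<not> covers (\<lambda>m. \<zeta> (level_code (a (snd z)) (y (snd z)) (k (snd z))) m (fst z))
      (rat_code (w (snd z)) (d (snd z))) (rat_code (Suc (w (snd z))) (d (snd z))))"
    by (intro kdec_not kdec_covers E1 kcomp_rat_code kcomp_Suc kcomp_bind[OF w] kcomp_bind[OF d])
  then show ?thesis
    unfolding Gdelta_hit_def
    using kdec_ex[OF E fl, of "\<lambda>n q. \<not> covers (\<lambda>m. \<zeta> (level_code (a q) (y q) (k q)) m n)
      (rat_code (w q) (d q)) (rat_code (Suc (w q)) (d q))"] by simp
qed

section \<open>Cantor realisers from (a), (b) and (c)\<close>

lemma cont_point_computes_cantor_realiser:
  assumes "cont_point_functional \<Phi>"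
  shows "\<exists>\<Theta>. cantor_realiser \<Theta> \<and> computable_cantor [OpR \<Phi>, Fun2 exists2] \<Theta>"
proof (intro exI conjI)
  let ?\<Theta> = "\<lambda>a y. \<Phi> (spike_code a y)"
  show "cantor_realiser ?\<Theta>"
    unfolding cantor_realiser_def
  proof (intro allI impI)
    fix A and Y :: "real \<Rightarrow> nat" assume "A \<subseteq> {0..1} \<and> A \<noteq> {} \<and> inj_on Y A"
    then have Y: "inj_on Y A" by simp
    have "rval (\<Phi> (spike_code (set_code A) (natfun_code Y))) \<in> cont_points (spike A Y)"
      using assms codes_fun_spike cliquish_spike[OF Y] by (auto simp: cont_point_functional_def)
    then show "rval (\<Phi> (spike_code (set_code A) (natfun_code Y))) \<in> {0..1} - A"
      by (simp add: cont_points_spike[OF Y])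
  qed
  show "computable_cantor [OpR \<Phi>, Fun2 exists2] ?\<Theta>"
    by (rule computable_cantorI, unfold append_Cons append_Nil, rule kcomp_OpR[OF _ kcomp_spike_code])
      (intro occurs_0 occurs_Suc kcomp_var fixed_length_Cons fixed_length_Nil)+
qed

lemma sup_computes_cantor_realiser:
  assumes "sup_functional \<Psi>"
  shows "\<exists>\<Theta>. cantor_realiser \<Theta> \<and> computable_cantor [OpRR \<Psi>, Fun2 exists2] \<Theta>"
proof (intro exI conjI)
  let ?\<Theta> = "\<lambda>a y. trisect_code (sup_hit \<Psi> a y)"
  show "cantor_realiser ?\<Theta>"
    by (rule cantor_realiserI) (rule locates_sup_hit[OF assms])
  let ?os = "\<lambda>q. [OpRR \<Psi>, Fun2 exists2, Fun2 (fst q), Fun2 (fst (snd q)), Num (snd (snd q))]"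
  have fl: "fixed_length ?os" by (intro fixed_length_Cons fixed_length_Nil)
  have n: "kcomp ?os (\<lambda>q. snd (snd q))" by (intro kcomp_var occurs_0 occurs_Suc fl)
  have os: "occurs ?os (\<lambda>q. OpRR \<Psi>)" "occurs ?os (\<lambda>q. Fun2 (fst q))" "occurs ?os (\<lambda>q. Fun2 (fst (snd q)))"
    by (intro occurs_0 occurs_Suc)+
  have "kcomp ?os (\<lambda>q. trisect_code (sup_hit \<Psi> (fst q) (fst (snd q))) (snd (snd q)))"
    by (rule kcomp_trisect_code[OF n], rule kdec_sup_hit[OF os[THEN occurs_bind2]])
      (intro kcomp_mult kcomp_power kcomp_Suc kcomp_const[OF fixed_length_bind2[OF fl]] kcomp_bind2_var[OF fl])+
  then show "computable_cantor [OpRR \<Psi>, Fun2 exists2] ?\<Theta>"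
    by (intro computable_cantorI) simp
qed

lemma Gdelta_computes_cantor_realiser:
  assumes "Gdelta_functional \<zeta>"
  shows "\<exists>\<Theta>. cantor_realiser \<Theta> \<and> computable_cantor [OpNN \<zeta>, Fun2 exists2] \<Theta>"
proof (intro exI conjI)
  let ?\<Theta> = "\<lambda>a y. trisect_code (Gdelta_hit \<zeta> a y)"
  show "cantor_realiser ?\<Theta>"
    by (rule cantor_realiserI) (rule locates_Gdelta_hit[OF assms])
  let ?os = "\<lambda>q. [OpNN \<zeta>, Fun2 exists2, Fun2 (fst q), Fun2 (fst (snd q)), Num (snd (snd q))]"
  have fl: "fixed_length ?os" by (intro fixed_length_Cons fixed_length_Nil)
  have n: "kcomp ?os (\<lambda>q. snd (snd q))" by (intro kcomp_var occurs_0 occurs_Suc fl)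
  have os: "occurs ?os (\<lambda>q. Fun2 exists2)" "occurs ?os (\<lambda>q. OpNN \<zeta>)"
    "occurs ?os (\<lambda>q. Fun2 (fst q))" "occurs ?os (\<lambda>q. Fun2 (fst (snd q)))"
    by (intro occurs_0 occurs_Suc)+
  have "kcomp ?os (\<lambda>q. trisect_code (Gdelta_hit \<zeta> (fst q) (fst (snd q))) (snd (snd q)))"
    by (rule kcomp_trisect_code[OF n], rule kdec_Gdelta_hit[OF os[THEN occurs_bind2]])
      (intro kcomp_mult kcomp_power kcomp_Suc kcomp_const[OF fixed_length_bind2[OF fl]] kcomp_bind2_var[OF fl])+
  then show "computable_cantor [OpNN \<zeta>, Fun2 exists2] ?\<Theta>"
    by (intro computable_cantorI) simp
qed

theorem theorem2:
  shows "(\<forall>k. (\<forall>\<Phi>. cont_point_functional \<Phi> \<longrightarrow> \<not> computable_R [Fun2 (Sk k)] \<Phi>) \<and>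
              (\<forall>\<Psi>. sup_functional \<Psi> \<longrightarrow> \<not> computable_RR [Fun2 (Sk k)] \<Psi>) \<and>
              (\<forall>\<zeta>. Gdelta_functional \<zeta> \<longrightarrow> \<not> computable_NN [Fun2 (Sk k)] \<zeta>)) \<and>
         (\<forall>\<Phi>. cont_point_functional \<Phi> \<longrightarrow>
            (\<exists>\<Theta>. cantor_realiser \<Theta> \<and> computable_cantor [OpR \<Phi>, Fun2 exists2] \<Theta>)) \<and>
         (\<forall>\<Psi>. sup_functional \<Psi> \<longrightarrow>
            (\<exists>\<Theta>. cantor_realiser \<Theta> \<and> computable_cantor [OpRR \<Psi>, Fun2 exists2] \<Theta>)) \<and>
         (\<forall>\<zeta>. Gdelta_functional \<zeta> \<longrightarrow>
            (\<exists>\<Theta>. cantor_realiser \<Theta> \<and> computable_cantor [OpNN \<zeta>, Fun2 exists2] \<Theta>))"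
  \<comment> \<open>The negative results hold for every type-2 \<open>H\<close>, in particular for
    each \<open>Sk k\<close>.\<close>
  using cont_point_not_computable sup_not_computable Gdelta_not_computable
    cont_point_computes_cantor_realiser sup_computes_cantor_realiser Gdelta_computes_cantor_realiser
  by (intro conjI allI impI)

end
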